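(* Let $L$ be a convex body in $\mathbb{R}^d$ with the origin as an interior point, let $X(t)$, $t\ge 0$, be the standard Brownian motion in $\mathbb{R}^d$ starting at the origin, and let $Z$ be the closed convex hull of $\{X(t):0\le t\le 1\}$. Then, for all $p\in[1,\infty)$, $$\mathbf{E}\,V_p(L,Z)=\frac{2^{p/2}}{\sqrt{\pi}}\,\Gamma\left(\frac{p+1}{2}\right)V_p(L,B^d),$$ where $B^d$ is the centred closed unit ball in $\mathbb{R}^d$.
   Context: A convex body is a non-empty compact convex set in $\mathbb{R}^d$, with support function $h(K,u)=\sup\{\langle x,u\rangle:x\in K\}$. For convex bodies $L,M$ containing the origin and $p\in[1,\infty)$, the $L_p$-sum $L+_pM$ is the convex body with $h(L+_pM,u)^p=h(L,u)^p+h(M,u)^p$, $u\in\mathbb{R}^d$. For convex bodies $L,M$ with the origin as an interior point, $V_p(L,M)=\frac{p}{d}\lim_{t\downarrow 0}\frac{V_d(L+_pt^{1/p}M)-V_d(L)}{t}$, where $V_d$ is Lebesgue measure. ($Z$ almost surely has the origin as an interior point.) *)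

theory Defs
  imports "HOL-Probability.Probability"
begin

definition convex_body :: "'a::euclidean_space set \<Rightarrow> bool" where
  "convex_body K \<longleftrightarrow> K \<noteq> {} \<and> compact K \<and> convex K"

definition support_function :: "'a::euclidean_space set \<Rightarrow> 'a \<Rightarrow> real" where
  "support_function K u = (SUP x\<in>K. x \<bullet> u)"

(* The condition 0 \<in> K makes the support function of K nonnegative, as is implicit in
   taking its p-th power for real p; together with the equation it determines K uniquely. *)
definition Lp_sum :: "real \<Rightarrow> 'a::euclidean_space set \<Rightarrow> 'a set \<Rightarrow> 'a set" where
  "Lp_sum p L M = (THE K. convex_body K \<and> 0 \<in> K \<and>
     (\<forall>u. support_function K u powr p = support_function L u powr p + support_function M u powr p))"

definition Lp_mixed_volume :: "real \<Rightarrow> 'a::euclidean_space set \<Rightarrow> 'a set \<Rightarrow> real" where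
  "Lp_mixed_volume p L M = p / real DIM('a) *
     Lim (at_right 0) (\<lambda>t. (measure lebesgue (Lp_sum p L ((*\<^sub>R) (t powr (1 / p)) ` M))
                            - measure lebesgue L) / t)"

(* The density in the third clause is that of N(0, (t - s) I): the coordinates are independent
   with variance t - s.  The start at the origin and the continuity of paths are only required
   almost surely, and M need not be complete; hence functionals of whole paths are in general
   measurable only with respect to completion M. *)
definition standard_brownian_motion ::
    "'w measure \<Rightarrow> (real \<Rightarrow> 'w \<Rightarrow> 'a::euclidean_space) \<Rightarrow> bool" where
  "standard_brownian_motion M X \<longleftrightarrow>
     prob_space M \<and>
     (\<forall>t\<ge>0. X t \<in> borel_measurable M) \<and>
     (\<forall>s t. 0 \<le> s \<and> s < t \<longrightarrow>
        distributed M lborel (\<lambda>\<omega>. X t \<omega> - X s \<omega>)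
          (\<lambda>x. ennreal (\<Prod>b\<in>Basis. normal_density 0 (sqrt (t - s)) (x \<bullet> b)))) \<and>
     (\<forall>(n::nat) \<tau>. 0 \<le> \<tau> 0 \<and> (\<forall>i<n. \<tau> i < \<tau> (Suc i)) \<longrightarrow>
        prob_space.indep_vars M (\<lambda>_. borel) (\<lambda>i \<omega>. X (\<tau> (Suc i)) \<omega> - X (\<tau> i) \<omega>) {..<n}) \<and>
     (AE \<omega> in M. X 0 \<omega> = 0) \<and>
     (AE \<omega> in M. continuous_on {0..} (\<lambda>t. X t \<omega>))"

definition path_hull :: "(real \<Rightarrow> 'w \<Rightarrow> 'a::euclidean_space) \<Rightarrow> 'w \<Rightarrow> 'a set" where
  "path_hull X \<omega> = closure (convex hull ((\<lambda>t. X t \<omega>) ` {0..1}))"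

end

(* Let h be the support function of L, S = {u. h u = 1}, and g x = SUP u:S. x . u the gauge of L.
   The gauge of L +_p t^(1/p) M is g_t x = SUP u:S. (x . u) (1 + t h(M,u)^p)^(-1/p), and
   integrating exp(-g_t) over R^d gives d! times the volume of the L_p-sum. Almost every x has a
   unique maximiser n(x) in S, and there g_t x is differentiable from the right at t = 0 with
   derivative -g(x) h(M,n(x))^p / p. Dominated convergence then yields
     V_p(L,M) = 1/(d d!) * integral of exp(-g(x)) g(x) h(M,n(x))^p dx,
   which is linear in h(M,.)^p. By Tonelli it remains to compute E h(Z,u)^p. Since h(Z,u) is the
   maximum over [0,1] of a one-dimensional Brownian motion with variance |u|^2 t, the reflection
   principle, proved on dyadic grids, shows that it is distributed as |u| |N| with N standard
   normal, so E h(Z,u)^p = |u|^p E|N|^p = h(B,u)^p E|N|^p. *)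
theory Submission
  imports Defs
begin

section \<open>Support functions and $L_p$-sums\<close>

text \<open>The image of exp(-g(x)) g(x) dx / (d d!) under x -> n(x) takes the place of the L_p
  surface area measure of L, so every integral is over Lebesgue measure and L may have corners and
  flat faces. The factor p/d of the definition of V_p meets the slope -1/p of (1 + t)^(-1/p) at 0,
  and d! is the integral of s^d exp(-s). Uniqueness of n(x) is the delicate point: two maximisers
  give g a kink at x, whose second difference at step \<delta> is of order \<delta>, whereas second
  differences integrated against a Lipschitz cut-off are of order \<delta>^2. Randomness raises
  another obstacle: on the null set of paths that jump or start elsewhere, nothing is known about
  V_p(L,Z). The expectation is therefore computed for a version built from suprema over dyadic
  times, which is measurable on the original space, and is then carried over to the completion. In
  the constant, the 2 of the reflection principle cancels the 1/2 in E max(0,N)^p = E|N|^p /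
  2.\<close>

lemma support_function_bdd:
  assumes "compact K"
  shows "bdd_above ((\<lambda>x. x \<bullet> u) ` K)"
  by (intro bounded_imp_bdd_above compact_imp_bounded compact_continuous_image assms continuous_intros)

lemma support_function_upper:
  assumes "compact K" "x \<in> K"
  shows "x \<bullet> u \<le> support_function K u"
  unfolding support_function_def by (intro cSUP_upper assms support_function_bdd)

lemma support_function_attained:
  assumes "compact K" "K \<noteq> {}"
  obtains x where "x \<in> K" "x \<bullet> u = support_function K u"
proof -
  have "continuous_on K (\<lambda>x. x \<bullet> u)" by (intro continuous_intros)
  then obtain x where x: "x \<in> K" "\<And>y. y \<in> K \<Longrightarrow> y \<bullet> u \<le> x \<bullet> u"
    using continuous_attains_sup[OF assms, of "\<lambda>x. x \<bullet> u"] by auto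
  have "support_function K u = x \<bullet> u"
    unfolding support_function_def using x by (intro cSup_eq_maximum) auto
  with x that show ?thesis by auto
qed

lemma support_function_eqI:
  assumes "\<And>x. x \<in> K \<Longrightarrow> x \<bullet> u \<le> c" "x \<in> K" "x \<bullet> u = c"
  shows "support_function K u = c"
  unfolding support_function_def using assms by (intro cSup_eq_maximum) auto

lemma support_function_nonneg:
  assumes "compact K" "0 \<in> K"
  shows "0 \<le> support_function K u"
  using support_function_upper[OF assms, of u] by simp

lemma support_function_lipschitz:
  assumes "compact K" "K \<noteq> {}" "\<And>x. x \<in> K \<Longrightarrow> norm x \<le> R"
  shows "\<bar>support_function K u - support_function K v\<bar> \<le> R * norm (u - v)"
proof -
  have *: "support_function K a - support_function K b \<le> R * norm (a - b)" for a b
  proof -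
    obtain x where x: "x \<in> K" "x \<bullet> a = support_function K a"
      using support_function_attained assms by blast
    have "support_function K a - support_function K b \<le> x \<bullet> (a - b)"
      using support_function_upper[OF assms(1) x(1), of b] x by (simp add: inner_diff_right)
    also have "\<dots> \<le> norm x * norm (a - b)" by (rule norm_cauchy_schwarz)
    also have "\<dots> \<le> R * norm (a - b)" by (intro mult_right_mono assms x) auto
    finally show ?thesis .
  qed
  from *[of u v] *[of v u] show ?thesis by (auto simp: norm_minus_commute)
qed

lemma continuous_on_support_function:
  assumes "compact K" "K \<noteq> {}"
  shows "continuous_on A (support_function K)"
proof -
  obtain R where R: "\<And>x. x \<in> K \<Longrightarrow> norm x \<le> R"
    using compact_imp_bounded[OF assms(1)] by (auto simp: bounded_iff)
  obtain x where "x \<in> K" using assms by auto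
  from R[OF this] have "0 \<le> R" using norm_ge_zero order_trans by blast
  then have "R-lipschitz_on A (support_function K)"
    using support_function_lipschitz[OF assms R] by (intro lipschitz_onI) (auto simp: dist_norm)
  then show ?thesis by (rule lipschitz_on_continuous_on)
qed

lemma support_function_scaleR:
  assumes "compact K" "K \<noteq> {}" "0 \<le> c"
  shows "support_function K (c *\<^sub>R u) = c * support_function K u"
proof -
  obtain x where x: "x \<in> K" "x \<bullet> u = support_function K u"
    using support_function_attained assms by blast
  show ?thesis
    using x support_function_upper[OF assms(1), of _ u] assms
    by (intro support_function_eqI[where x = x]) (auto intro: mult_left_mono)
qed

lemma support_function_scaleR_image:
  assumes "compact K" "K \<noteq> {}" "0 \<le> c"
  shows "support_function ((*\<^sub>R) c ` K) u = c * support_function K u"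
proof -
  obtain x where x: "x \<in> K" "x \<bullet> u = support_function K u"
    using support_function_attained assms by blast
  show ?thesis
    using x support_function_upper[OF assms(1), of _ u] assms
    by (intro support_function_eqI[where x = "c *\<^sub>R x"]) (auto intro!: mult_left_mono)
qed

text \<open>A point outside a compact convex set is strictly separated from it by a hyperplane. A
  body is thus recovered from its support function, which gives both the uniqueness of
  \<open>Lp_sum\<close> and the sublevel sets of \<open>wgauge\<close>.\<close>

lemma mem_convex_body_iff:
  assumes "convex_body K"
  shows "x \<in> K \<longleftrightarrow> (\<forall>u. x \<bullet> u \<le> support_function K u)"
proof
  assume "x \<in> K" then show "\<forall>u. x \<bullet> u \<le> support_function K u"
    using support_function_upper assms by (auto simp: convex_body_def)
next
  assume *: "\<forall>u. x \<bullet> u \<le> support_function K u"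
  show "x \<in> K"
  proof (rule ccontr)
    assume "x \<notin> K"
    then obtain a b where ab: "a \<bullet> x < b" "\<And>y. y \<in> K \<Longrightarrow> a \<bullet> y > b"
      using separating_hyperplane_closed_point[of K x] assms
      by (auto simp: convex_body_def compact_imp_closed)
    obtain y where y: "y \<in> K" "y \<bullet> (-a) = support_function K (-a)"
      using support_function_attained assms unfolding convex_body_def by blast
    from *[rule_format, of "-a"] y ab(1) ab(2)[OF y(1)] show False
      by (simp add: inner_commute)
  qed
qed

section \<open>Existence and uniqueness of the L_p-sum\<close>

lemma powr_Young:
  fixes x y p :: real
  assumes "1 \<le> p" "0 \<le> x" "0 \<le> y"
  shows "x powr (p - 1) * y \<le> (p - 1) / p * x powr p + y powr p / p"
proof (cases "p = 1")
  case True
  then show ?thesis using assms by (auto simp: powr_def)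
next
  case False
  then have p: "p > 1" using assms by simp
  \<comment> \<open>Young's inequality for the conjugate exponents \<open>p\<close> and
    \<open>p / (p - 1)\<close>; for \<open>p = 1\<close> the second would be infinite, hence the
    separate case.\<close>
  have "y * x powr (p - 1) \<le> y powr p / p + (x powr (p - 1)) powr (p / (p - 1)) / (p / (p - 1))"
    using p assms by (intro Youngs_inequality) (auto simp: field_simps)
  then show ?thesis using p by (simp add: powr_powr mult.commute add.commute)
qed

text \<open>The unit ball of the dual of the planar $p$-norm, restricted to the positive quadrant.\<close>

definition dual_quadrant :: "real \<Rightarrow> (real \<times> real) set" where
  "dual_quadrant p = {(a, b). 0 \<le> a \<and> 0 \<le> b \<and>
     (\<forall>s\<ge>0. \<forall>t\<ge>0. a * s + b * t \<le> (s powr p + t powr p) powr (1 / p))}"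

text \<open>Each pair \<open>s\<close>, \<open>t\<close> cuts out a closed half-plane, and the pairs
  \<open>(1, 0)\<close> and \<open>(0, 1)\<close> confine the set to the unit square. Describing it
  by these inequalities rather than by a conjugate exponent treats \<open>p = 1\<close> on the same
  footing.\<close>

lemma compact_dual_quadrant:
  assumes "1 \<le> p"
  shows "compact (dual_quadrant p)"
proof -
  have eq: "dual_quadrant p = {ab. 0 \<le> fst ab} \<inter> {ab. 0 \<le> snd ab} \<inter>
     (\<Inter>s\<in>{0..}. \<Inter>t\<in>{0..}. {ab. fst ab * s + snd ab * t \<le> (s powr p + t powr p) powr (1 / p)})"
    by (auto simp: dual_quadrant_def)
  have "closed (dual_quadrant p)"
    unfolding eq by (intro closed_Int closed_INT ballI closed_Collect_le continuous_intros)
  moreover have "dual_quadrant p \<subseteq> cbox (0, 0) (1, 1)"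
  proof
    fix ab assume "ab \<in> dual_quadrant p"
    moreover obtain a b where "ab = (a, b)" by (cases ab)
    ultimately have ab: "(a, b) \<in> dual_quadrant p" "ab = (a, b)" by auto
    then have *: "\<forall>s\<ge>0. \<forall>t\<ge>0. a * s + b * t \<le> (s powr p + t powr p) powr (1 / p)"
      by (simp add: dual_quadrant_def)
    have "a \<le> 1" using *[rule_format, of 1 0] by simp
    moreover have "b \<le> 1" using *[rule_format, of 0 1] by simp
    ultimately show "ab \<in> cbox (0, 0) (1, 1)" using ab by (auto simp: dual_quadrant_def cbox_Pair_eq)
  qed
  ultimately show ?thesis
    using bounded_cbox bounded_subset compact_eq_bounded_closed by blast
qed

text \<open>Equality in Hoelder's inequality: the dual vector is the gradient of the p-norm at
  \<open>(s, t)\<close>, which is available away from the origin. At the origin any point of the set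
  will do.\<close>

lemma dual_quadrant_attains:
  assumes "1 \<le> p" "0 \<le> s" "0 \<le> t"
  obtains a b where "(a, b) \<in> dual_quadrant p" "a * s + b * t = (s powr p + t powr p) powr (1 / p)"
proof (cases "s = 0 \<and> t = 0")
  case True
  then show ?thesis
    using assms by (intro that[of 0 0]) (auto simp: dual_quadrant_def)
next
  case False
  define N where "N s t = (s powr p + t powr p) powr (1 / p)" for s t :: real
  have N_nonneg: "0 \<le> N s t" for s t by (simp add: N_def)
  have Np: "N s t powr p = s powr p + t powr p" for s t
    using assms by (simp add: N_def powr_powr add_nonneg_nonneg)
  have N_pos: "0 < N s t"
    using False assms by (auto simp: N_def add_nonneg_eq_0_iff)
  \<comment> \<open>Partial derivatives of the p-norm \<open>N\<close> at \<open>(s, t)\<close>.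
    Being homogeneous of degree one, \<open>N\<close> equals the pairing of its gradient with
    \<open>(s, t)\<close>.\<close>
  define a where "a = (s / N s t) powr (p - 1)"
  define b where "b = (t / N s t) powr (p - 1)"
  have norm1: "(s / N s t) powr p + (t / N s t) powr p = 1"
    using N_pos assms Np[of s t] powr_gt_zero[of "N s t" p]
    by (simp add: powr_divide add_divide_distrib[symmetric] del: powr_gt_zero)
  have powr_pm1: "x powr (p - 1) * x = x powr p" if "0 \<le> x" for x :: real
    using that assms by (cases "x = 0") (auto simp: powr_diff)
  have "a * s + b * t = N s t * ((s / N s t) powr (p - 1) * (s / N s t) + (t / N s t) powr (p - 1) * (t / N s t))"
    using N_pos by (simp add: a_def b_def field_simps)
  also have "\<dots> = N s t"
    using N_pos assms norm1 by (simp add: powr_pm1 del: times_divide_eq_right)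
  finally have 1: "a * s + b * t = N s t" .
  have "a * s' + b * t' \<le> N s' t'" if st: "0 \<le> s'" "0 \<le> t'" for s' t'
  proof (cases "N s' t' = 0")
    case True
    then have "s' = 0 \<and> t' = 0"
      using st by (simp add: N_def add_nonneg_eq_0_iff)
    then show ?thesis using N_nonneg by simp
  next
    case False
    then have N': "0 < N s' t'" using N_nonneg[of s' t'] by simp
    have norm2: "(s' / N s' t') powr p + (t' / N s' t') powr p = 1"
      using N' st Np[of s' t'] powr_gt_zero[of "N s' t'" p]
      by (simp add: powr_divide add_divide_distrib[symmetric] del: powr_gt_zero)
    \<comment> \<open>Both vectors have been scaled to p-norm one, so Young's inequality in each
      coordinate adds up to (p - 1)/p + 1/p = 1.\<close>
    have "a * (s' / N s' t') + b * (t' / N s' t') \<le>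
       ((p - 1) / p * (s / N s t) powr p + (s' / N s' t') powr p / p) +
       ((p - 1) / p * (t / N s t) powr p + (t' / N s' t') powr p / p)"
      unfolding a_def b_def using assms N_pos N' st by (intro add_mono powr_Young) auto
    also have "\<dots> = (p - 1) / p * ((s / N s t) powr p + (t / N s t) powr p) +
        ((s' / N s' t') powr p + (t' / N s' t') powr p) / p"
      by (simp add: algebra_simps add_divide_distrib)
    also have "\<dots> = 1" unfolding norm1 norm2 using assms by (simp add: field_simps)
    finally show ?thesis using N' by (simp add: field_simps)
  qed
  then have "(a, b) \<in> dual_quadrant p"
    by (auto simp: dual_quadrant_def N_def a_def b_def)
  with 1 show ?thesis using that by (simp add: N_def)
qed

text \<open>The sum is built from all a L + b M with (a, b) in the dual quadrant: maximising a
  h(L,u) + b h(M,u) over that set gives the p-norm of these two nonnegative numbers. The convex hull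
  leaves support functions unchanged and secures convexity.\<close>

lemma Lp_sum_exists:
  assumes p: "1 \<le> p" and L: "convex_body L" "0 \<in> L" and M: "convex_body M" "0 \<in> M"
  shows "\<exists>K. convex_body K \<and> 0 \<in> K \<and>
     (\<forall>u. support_function K u powr p = support_function L u powr p + support_function M u powr p)"
proof -
  define f where "f = (\<lambda>z::(real \<times> real) \<times> ('a \<times> 'a). fst (fst z) *\<^sub>R fst (snd z) + snd (fst z) *\<^sub>R snd (snd z))"
  define T where "T = f ` (dual_quadrant p \<times> (L \<times> M))"
  define K where "K = convex hull T"
  have "compact T"
    unfolding T_def f_def using L M p
    by (intro compact_continuous_image compact_Times compact_dual_quadrant continuous_intros)
       (auto simp: convex_body_def)
  then have "compact K" unfolding K_def by (rule compact_convex_hull)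
  have "(0, 0) \<in> dual_quadrant p" using p by (auto simp: dual_quadrant_def)
  then have "0 \<in> T" unfolding T_def using L M by (force simp: f_def intro!: image_eqI[where x = "((0,0),(0,0))"])
  then have 0: "0 \<in> K" unfolding K_def by (rule hull_inc)
  have "support_function K u = (support_function L u powr p + support_function M u powr p) powr (1 / p)" for u
  proof -
    have nn: "0 \<le> support_function L u" "0 \<le> support_function M u"
      using L M by (auto intro!: support_function_nonneg simp: convex_body_def)
    obtain a b where ab: "(a, b) \<in> dual_quadrant p"
      "a * support_function L u + b * support_function M u = (support_function L u powr p + support_function M u powr p) powr (1 / p)"
      using dual_quadrant_attains[OF p nn] by blast
    obtain x where x: "x \<in> L" "x \<bullet> u = support_function L u"
      using support_function_attained L by (auto simp: convex_body_def)
    obtain y where y: "y \<in> M" "y \<bullet> u = support_function M u"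
      using support_function_attained M by (auto simp: convex_body_def)
    show ?thesis
    proof (rule support_function_eqI)
      have "a *\<^sub>R x + b *\<^sub>R y \<in> T"
        unfolding T_def using ab x y by (force simp: f_def intro!: image_eqI[where x = "((a,b),(x,y))"])
      then show "a *\<^sub>R x + b *\<^sub>R y \<in> K" unfolding K_def by (rule hull_inc)
      show "(a *\<^sub>R x + b *\<^sub>R y) \<bullet> u = (support_function L u powr p + support_function M u powr p) powr (1 / p)"
        using ab x y by (simp add: inner_add_left)
    next
      fix z assume "z \<in> K"
      have "T \<subseteq> {z. u \<bullet> z \<le> (support_function L u powr p + support_function M u powr p) powr (1 / p)}"
      proof
        fix z assume "z \<in> T"
        then obtain a b x y where z: "(a, b) \<in> dual_quadrant p" "x \<in> L" "y \<in> M" "z = a *\<^sub>R x + b *\<^sub>R y"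
          by (auto simp: T_def f_def)
        then have "0 \<le> a" "0 \<le> b" by (auto simp: dual_quadrant_def)
        moreover have "x \<bullet> u \<le> support_function L u" "y \<bullet> u \<le> support_function M u"
          using z L M by (auto intro!: support_function_upper simp: convex_body_def)
        ultimately have "z \<bullet> u \<le> a * support_function L u + b * support_function M u"
          unfolding z by (auto simp: inner_add_left intro!: add_mono mult_left_mono)
        also have "\<dots> \<le> (support_function L u powr p + support_function M u powr p) powr (1 / p)"
          using z nn by (auto simp: dual_quadrant_def)
        finally show "z \<in> {z. u \<bullet> z \<le> (support_function L u powr p + support_function M u powr p) powr (1 / p)}"
          by (simp add: inner_commute)
      qed
      then have "K \<subseteq> {z. u \<bullet> z \<le> (support_function L u powr p + support_function M u powr p) powr (1 / p)}"
        unfolding K_def by (rule hull_minimal) (rule convex_halfspace_le)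
      with \<open>z \<in> K\<close> show "z \<bullet> u \<le> (support_function L u powr p + support_function M u powr p) powr (1 / p)"
        by (auto simp: inner_commute)
    qed
  qed
  then have "\<forall>u. support_function K u powr p = support_function L u powr p + support_function M u powr p"
    using p by (simp add: powr_powr add_nonneg_nonneg)
  moreover have "convex_body K"
    using \<open>compact K\<close> 0 by (auto simp: convex_body_def K_def)
  ultimately show ?thesis using 0 by blast
qed

text \<open>The definite description in \<open>Lp_sum\<close> denotes: p-th powers of nonnegative
  numbers are injective, so the equation fixes the support function of \<open>K\<close>, and that
  fixes \<open>K\<close>.\<close>

lemma Lp_sum_props:
  assumes p: "1 \<le> p" and L: "convex_body L" "0 \<in> L" and M: "convex_body M" "0 \<in> M"
  shows "convex_body (Lp_sum p L M)" "0 \<in> Lp_sum p L M"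
    "support_function (Lp_sum p L M) u powr p = support_function L u powr p + support_function M u powr p"
proof -
  let ?P = "\<lambda>K. convex_body K \<and> 0 \<in> K \<and>
     (\<forall>u. support_function K u powr p = support_function L u powr p + support_function M u powr p)"
  have uniq: "K = K'" if "?P K" "?P K'" for K K' :: "'a set"
  proof -
    have "support_function K u = support_function K' u" for u
    proof -
      have "support_function K u powr p = support_function K' u powr p" using that by simp
      moreover have "0 \<le> support_function K u" "0 \<le> support_function K' u"
        using that by (auto intro!: support_function_nonneg simp: convex_body_def)
      ultimately show ?thesis
        using p powr_less_mono2[of p] by (metis less_le_trans less_irrefl linorder_neqE_linordered_idom zero_less_one)
    qed
    then show ?thesis using that by (auto simp: set_eq_iff mem_convex_body_iff)
  qed
  have "\<exists>!K. ?P K" using Lp_sum_exists[OF assms] uniq by blast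
  from theI'[OF this] show "convex_body (Lp_sum p L M)" "0 \<in> Lp_sum p L M"
    "support_function (Lp_sum p L M) u powr p = support_function L u powr p + support_function M u powr p"
    unfolding Lp_sum_def by blast+
qed

section \<open>Volume as an exponential integral of the gauge function\<close>

lemma powr_one_plus_slope:
  fixes c p :: real
  assumes "p \<noteq> 0"
  shows "((\<lambda>t. (1 - (1 + t * c) powr (- 1 / p)) / t) \<longlongrightarrow> c / p) (at_right 0)"
proof -
  have "((\<lambda>t. (1 + t * c) powr (- 1 / p)) has_real_derivative (- 1 / p) * c) (at 0)"
    using assms by (auto intro!: derivative_eq_intros)
  then have "((\<lambda>t. ((1 + t * c) powr (- 1 / p) - 1) / t) \<longlongrightarrow> (- 1 / p) * c) (at 0)"
    by (simp add: DERIV_def)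
  then have "((\<lambda>t. - (((1 + t * c) powr (- 1 / p) - 1) / t)) \<longlongrightarrow> - ((- 1 / p) * c)) (at 0)"
    by (rule tendsto_minus)
  then have "((\<lambda>t. (1 - (1 + t * c) powr (- 1 / p)) / t) \<longlongrightarrow> c / p) (at 0)"
    by (simp only: minus_divide_left minus_diff_eq) simp
  then show ?thesis by (rule filterlim_mono) (auto intro: at_le)
qed

text \<open>Since \<open>p \<ge> 1\<close>, the power dominates 1 / (1 + y). A loss that is linear
  in \<open>y\<close> keeps difference quotients in \<open>t\<close> bounded uniformly, as dominated
  convergence demands.\<close>

lemma one_plus_powr_ge:
  fixes y p :: real
  assumes "0 \<le> y" "1 \<le> p"
  shows "1 - y \<le> (1 + y) powr (- 1 / p)"
proof -
  have "1 - y \<le> 1 / (1 + y)"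
    using assms by (simp add: field_simps)
  also have "\<dots> = (1 + y) powr (- 1)" using assms by (simp add: powr_minus_divide)
  also have "\<dots> \<le> (1 + y) powr (- 1 / p)"
    using assms by (intro powr_mono) (auto simp: field_simps)
  finally show ?thesis .
qed

section \<open>Gauge functions with weights on the polar boundary\<close>

locale pointed_body =
  fixes L :: "'a::euclidean_space set"
  assumes body: "convex_body L" and interior0: "0 \<in> interior L"
begin

abbreviation "h \<equiv> support_function L"

text \<open>The boundary of the polar body of \<open>L\<close>, because \<open>h\<close> is the
  gauge of the polar. It is compact and meets every ray from the origin exactly once.\<close>

definition S :: "'a set" where "S = {u. h u = 1}"

text \<open>For positive weights this is the gauge of the body cut out by x . u \<le> 1 / \<phi>(u)
  for u in \<open>S\<close>. Perturbing \<open>L\<close> changes only the weight while the index set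
  stays fixed, so that maximisers for different bodies can be compared.\<close>

definition wgauge :: "('a \<Rightarrow> real) \<Rightarrow> 'a \<Rightarrow> real" where
  "wgauge \<phi> x = (SUP u\<in>S. (x \<bullet> u) * \<phi> u)"

abbreviation g :: "'a \<Rightarrow> real" where "g \<equiv> wgauge (\<lambda>_. 1)"

lemma zero_mem: "0 \<in> L" using interior0 interior_subset by auto

lemma compact_L: "compact L" using body by (simp add: convex_body_def)

lemma L_nonempty: "L \<noteq> {}" using zero_mem by auto

lemma support_ge_norm:
  obtains r where "0 < r" "\<And>u. r * norm u \<le> h u"
proof -
  obtain r where r: "r > 0" "cball 0 r \<subseteq> L"
    using interior0 by (meson mem_interior_cball)
  have "r * norm u \<le> h u" for u
  proof (cases "u = 0")
    case True then show ?thesis using support_function_nonneg[OF compact_L zero_mem] by simp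
  next
    case False
    let ?x = "(r / norm u) *\<^sub>R u"
    have "?x \<in> L" using r False by (intro subsetD[OF r(2)]) auto
    from support_function_upper[OF compact_L this, of u] False show ?thesis
      by (simp add: dot_square_norm power2_eq_square)
  qed
  with r that show ?thesis by blast
qed

lemma support_pos: "u \<noteq> 0 \<Longrightarrow> 0 < h u"
  using support_ge_norm by (metis less_le_trans mult_pos_pos zero_less_norm_iff)

lemma normalize_in_S:
  assumes "u \<noteq> 0"
  shows "(1 / h u) *\<^sub>R u \<in> S"
  using support_pos[OF assms] by (simp add: S_def support_function_scaleR[OF compact_L L_nonempty])

lemma compact_S: "compact S"
proof -
  have "closed S"
    unfolding S_def using continuous_on_support_function[OF compact_L L_nonempty]
    by (intro closed_Collect_eq continuous_on_const) auto
  moreover obtain r where r: "0 < r" "\<And>u. r * norm u \<le> h u"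
    using support_ge_norm by blast
  have "bounded S"
    using r by (auto simp: bounded_iff S_def field_simps intro!: exI[of _ "1 / r"]) (metis)
  ultimately show ?thesis by (simp add: compact_eq_bounded_closed)
qed

lemma S_nonempty: "S \<noteq> {}"
proof -
  obtain b :: 'a where "b \<in> Basis" using nonempty_Basis by blast
  then show ?thesis using normalize_in_S[of b] by (auto simp: nonzero_Basis)
qed

lemma wgauge_continuous_image:
  assumes "continuous_on S \<phi>"
  shows "continuous_on S (\<lambda>u. (x \<bullet> u) * \<phi> u)"
  by (intro continuous_intros assms)

lemma wgauge_upper:
  assumes "continuous_on S \<phi>" "u \<in> S"
  shows "(x \<bullet> u) * \<phi> u \<le> wgauge \<phi> x"
  unfolding wgauge_def
  by (intro cSUP_upper assms bounded_imp_bdd_above compact_imp_bounded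
      compact_continuous_image compact_S wgauge_continuous_image)

lemma wgauge_attained:
  assumes "continuous_on S \<phi>"
  obtains u where "u \<in> S" "wgauge \<phi> x = (x \<bullet> u) * \<phi> u"
proof -
  obtain u where u: "u \<in> S" "\<And>v. v \<in> S \<Longrightarrow> (x \<bullet> v) * \<phi> v \<le> (x \<bullet> u) * \<phi> u"
    using continuous_attains_sup[OF compact_S S_nonempty wgauge_continuous_image[OF assms]] by blast
  have "wgauge \<phi> x = (x \<bullet> u) * \<phi> u"
    unfolding wgauge_def using u by (intro cSup_eq_maximum) auto
  with u that show ?thesis by blast
qed

lemma wgauge_le_iff:
  assumes "continuous_on S \<phi>"
  shows "wgauge \<phi> x \<le> s \<longleftrightarrow> (\<forall>u\<in>S. (x \<bullet> u) * \<phi> u \<le> s)"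
  using wgauge_upper[OF assms] wgauge_attained[OF assms, of x] by (metis order_trans)

lemma wgauge_nonneg:
  assumes "continuous_on S \<phi>" "\<And>u. u \<in> S \<Longrightarrow> 0 \<le> \<phi> u"
  shows "0 \<le> wgauge \<phi> x"
proof (cases "x = 0")
  case True
  then show ?thesis using S_nonempty wgauge_upper[OF assms(1), of _ x] by auto
next
  case False
  \<comment> \<open>The point of \<open>S\<close> on the ray through \<open>x\<close> always pairs
    nonnegatively with \<open>x\<close>.\<close>
  have "0 \<le> (x \<bullet> ((1 / h x) *\<^sub>R x)) * \<phi> ((1 / h x) *\<^sub>R x)"
    using support_pos[OF False] assms(2)[OF normalize_in_S[OF False]] by simp
  then show ?thesis using wgauge_upper[OF assms(1) normalize_in_S[OF False], of x] by simp
qed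

lemma g_pos:
  assumes "x \<noteq> 0"
  shows "0 < g x"
proof -
  have "0 < x \<bullet> ((1 / h x) *\<^sub>R x)" using assms support_pos[OF assms] by simp
  also have "\<dots> \<le> g x" using wgauge_upper[OF _ normalize_in_S[OF assms], of "\<lambda>_. 1" x] by simp
  finally show ?thesis .
qed

text \<open>A supremum of linear functionals has any bound on the norms of the representing vectors
  \<open>\<phi> u *\<^sub>R u\<close> as a Lipschitz constant.\<close>

lemma wgauge_lipschitz:
  assumes "continuous_on S \<phi>"
  obtains C where "0 \<le> C" "\<And>x y. \<bar>wgauge \<phi> x - wgauge \<phi> y\<bar> \<le> C * norm (x - y)"
proof -
  have "bounded ((\<lambda>u. \<phi> u *\<^sub>R u) ` S)"
    by (intro compact_imp_bounded compact_continuous_image compact_S continuous_intros assms)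
  then obtain C where C: "0 < C" "\<And>u. u \<in> S \<Longrightarrow> norm (\<phi> u *\<^sub>R u) \<le> C"
    by (auto simp: bounded_pos)
  have *: "wgauge \<phi> x - wgauge \<phi> y \<le> C * norm (x - y)" for x y
  proof -
    obtain u where u: "u \<in> S" "wgauge \<phi> x = (x \<bullet> u) * \<phi> u"
      using wgauge_attained[OF assms] by blast
    have "wgauge \<phi> x - wgauge \<phi> y \<le> (x - y) \<bullet> (\<phi> u *\<^sub>R u)"
      using wgauge_upper[OF assms u(1), of y] u by (simp add: inner_diff_left algebra_simps)
    also have "\<dots> \<le> norm (x - y) * norm (\<phi> u *\<^sub>R u)" by (rule norm_cauchy_schwarz)
    also have "\<dots> \<le> norm (x - y) * C" by (intro mult_left_mono C u) auto
    finally show ?thesis by (simp add: mult.commute)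
  qed
  have "\<bar>wgauge \<phi> x - wgauge \<phi> y\<bar> \<le> C * norm (x - y)" for x y
    using *[of x y] *[of y x] by (auto simp: norm_minus_commute)
  with C that[of C] show ?thesis by auto
qed

lemma continuous_on_wgauge:
  assumes "continuous_on S \<phi>"
  shows "continuous_on A (wgauge \<phi>)"
proof -
  obtain C where "0 \<le> C" "\<And>x y. \<bar>wgauge \<phi> x - wgauge \<phi> y\<bar> \<le> C * norm (x - y)"
    using wgauge_lipschitz[OF assms] by blast
  then have "C-lipschitz_on A (wgauge \<phi>)"
    by (intro lipschitz_onI) (auto simp: dist_norm)
  then show ?thesis by (rule lipschitz_on_continuous_on)
qed

lemma borel_measurable_wgauge:
  "continuous_on S \<phi> \<Longrightarrow> wgauge \<phi> \<in> borel_measurable borel"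
  by (intro borel_measurable_continuous_onI continuous_on_wgauge)

text \<open>Where \<open>\<phi>\<close> is the reciprocal of the support function of
  \<open>K\<close>, the constraint for \<open>u\<close> reads x . u \<le> s h(K,u). Every nonzero
  direction is a positive multiple of a point of \<open>S\<close>, so by homogeneity the constraints
  on \<open>S\<close> amount to all supporting halfspaces of s K.\<close>

lemma wgauge_sublevel:
  assumes \<phi>: "continuous_on S \<phi>" "\<And>u. u \<in> S \<Longrightarrow> 0 < \<phi> u"
    and K: "convex_body K" "0 \<in> K" "\<And>u. u \<in> S \<Longrightarrow> support_function K u * \<phi> u = 1"
    and s: "0 < s"
  shows "{x. wgauge \<phi> x \<le> s} = (*\<^sub>R) s ` K"
proof -
  have cK: "compact K" "K \<noteq> {}" using K by (auto simp: convex_body_def)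
  have iff: "wgauge \<phi> x \<le> s \<longleftrightarrow> (1 / s) *\<^sub>R x \<in> K" for x
  proof -
    have hK: "support_function K u = 1 / \<phi> u" if "u \<in> S" for u
      using K(3)[OF that] \<phi>(2)[OF that] by (simp add: field_simps)
    have "wgauge \<phi> x \<le> s \<longleftrightarrow> (\<forall>u\<in>S. ((1 / s) *\<^sub>R x) \<bullet> u \<le> support_function K u)"
      using s \<phi>(2) hK by (auto simp: wgauge_le_iff[OF \<phi>(1)] field_simps)
    also have "\<dots> \<longleftrightarrow> (\<forall>u. ((1 / s) *\<^sub>R x) \<bullet> u \<le> support_function K u)"
    proof safe
      fix u assume *: "\<forall>u\<in>S. ((1 / s) *\<^sub>R x) \<bullet> u \<le> support_function K u"
      show "((1 / s) *\<^sub>R x) \<bullet> u \<le> support_function K u"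
      proof (cases "u = 0")
        case True then show ?thesis using support_function_nonneg[OF cK(1) K(2), of u] by simp
      next
        case False
        from *[rule_format, OF normalize_in_S[OF False]] support_pos[OF False] show ?thesis
          by (simp add: support_function_scaleR[OF cK] divide_right_mono field_simps)
      qed
    qed auto
    also have "\<dots> \<longleftrightarrow> (1 / s) *\<^sub>R x \<in> K"
      using mem_convex_body_iff[OF K(1)] by simp
    finally show ?thesis .
  qed
  show ?thesis
  proof safe
    fix x assume "wgauge \<phi> x \<le> s"
    then show "x \<in> (*\<^sub>R) s ` K" using s iff by (intro image_eqI[where x = "(1 / s) *\<^sub>R x"]) auto
  next
    fix x assume "x \<in> K" then show "wgauge \<phi> (s *\<^sub>R x) \<le> s" using s by (simp add: iff)
  qed
qed

text \<open>Write exp(-a) as the integral of exp(-s) over s \<ge> a and exchange the integrals: the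
  sublevel set at height s is s K, with volume s^d times that of K, and the integral of s^d exp(-s)
  is d!. Nonnegative integrals give integrability along with the value.\<close>

lemma nn_integral_exp_wgauge:
  assumes \<phi>: "continuous_on S \<phi>" "\<And>u. u \<in> S \<Longrightarrow> 0 < \<phi> u"
    and K: "convex_body K" "0 \<in> K" "\<And>u. u \<in> S \<Longrightarrow> support_function K u * \<phi> u = 1"
  shows "(\<integral>\<^sup>+x. ennreal (exp (- wgauge \<phi> x)) \<partial>lborel) = ennreal (measure lebesgue K * fact DIM('a))"
proof -
  have [measurable]: "wgauge \<phi> \<in> borel_measurable borel" by (rule borel_measurable_wgauge[OF \<phi>(1)])
  have nn: "0 \<le> wgauge \<phi> x" for x using \<phi> by (intro wgauge_nonneg) (auto intro: less_imp_le)
  have cK: "compact K" using K by (simp add: convex_body_def)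
  have exp_Ici: "ennreal (exp (- a)) = (\<integral>\<^sup>+s. ennreal (exp (- s)) * indicator {a..} s \<partial>lborel)" for a :: real
  proof -
    have "((\<lambda>x::real. - exp (- x)) \<longlongrightarrow> - 0) at_top"
      by (intro tendsto_minus filterlim_compose[OF exp_at_bot] filterlim_uminus_at_bot_at_top)
    then have "(\<integral>\<^sup>+s. ennreal (exp (- s)) * indicator {a..} s \<partial>lborel) = 0 - (- exp (- a))"
      by (intro nn_integral_FTC_atLeast) (auto intro!: derivative_eq_intros)
    then show ?thesis by simp
  qed
  have "(\<integral>\<^sup>+x. ennreal (exp (- wgauge \<phi> x)) \<partial>lborel)
      = (\<integral>\<^sup>+x. \<integral>\<^sup>+s. ennreal (exp (- s)) * indicator {wgauge \<phi> x..} s \<partial>lborel \<partial>lborel)"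
    by (subst exp_Ici) simp
  also have "\<dots> = (\<integral>\<^sup>+s. \<integral>\<^sup>+x. ennreal (exp (- s)) * indicator {wgauge \<phi> x..} s \<partial>lborel \<partial>lborel)"
    by (rule lborel_pair.Fubini') (auto simp: indicator_def cong: measurable_cong)
  also have "\<dots> = (\<integral>\<^sup>+s. ennreal (s ^ DIM('a) * exp (- s)) * indicator {0..} s * ennreal (measure lebesgue K) \<partial>lborel)"
  proof (rule nn_integral_cong_AE)
    \<comment> \<open>At \<open>s = 0\<close> the sublevel set is not covered by
      \<open>wgauge_sublevel\<close>; a single height is negligible.\<close>
    have "AE s in lborel. s \<noteq> (0::real)" by (rule AE_lborel_singleton)
    then show "AE s in lborel. (\<integral>\<^sup>+x. ennreal (exp (- s)) * indicator {wgauge \<phi> x..} s \<partial>lborel)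
       = ennreal (s ^ DIM('a) * exp (- s)) * indicator {0..} s * ennreal (measure lebesgue K)"
    proof eventually_elim
      case (elim s)
      show ?case
      proof (cases "s < 0")
        case True
        then have "s \<notin> {wgauge \<phi> x..}" for x using nn[of x] by auto
        then show ?thesis using True by simp
      next
        case False
        with elim have s: "0 < s" by simp
        have "(\<integral>\<^sup>+x. ennreal (exp (- s)) * indicator {wgauge \<phi> x..} s \<partial>lborel)
          = (\<integral>\<^sup>+x. ennreal (exp (- s)) * indicator {x. wgauge \<phi> x \<le> s} x \<partial>lborel)"
          by (intro nn_integral_cong) (auto simp: indicator_def)
        also have "\<dots> = ennreal (exp (- s)) * emeasure lborel {x. wgauge \<phi> x \<le> s}"
          by (intro nn_integral_cmult_indicator) measurable
        also have "emeasure lborel {x. wgauge \<phi> x \<le> s} = emeasure lebesgue {x. wgauge \<phi> x \<le> s}"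
          by simp
        also have "\<dots> = emeasure lebesgue ((*\<^sub>R) s ` K)"
          by (simp only: wgauge_sublevel[OF \<phi> K s])
        also have "\<dots> = ennreal (s ^ DIM('a)) * emeasure lebesgue K"
          using emeasure_lebesgue_affine[of s 0 K] s by (simp add: ennreal_power)
        also have "emeasure lebesgue K = ennreal (measure lebesgue K)"
          using lmeasurable_compact[OF cK] by (intro emeasure_eq_measure2) (auto simp: fmeasurable_def)
        finally show ?thesis using s by (simp add: ennreal_mult' mult_ac)
      qed
    qed
  qed
  also have "\<dots> = (\<integral>\<^sup>+s. ennreal (s ^ DIM('a) * exp (- s)) * indicator {0..} s \<partial>lborel) * ennreal (measure lebesgue K)"
    by (rule nn_integral_multc) measurable
  also have "\<dots> = ennreal (measure lebesgue K * fact DIM('a))"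
    by (subst nn_intergal_power_times_exp_Ici)
       (simp add: ennreal_mult' mult.commute ennreal_of_nat_eq_real_of_nat)
  finally show ?thesis .
qed

lemma
  assumes \<phi>: "continuous_on S \<phi>" "\<And>u. u \<in> S \<Longrightarrow> 0 < \<phi> u"
    and K: "convex_body K" "0 \<in> K" "\<And>u. u \<in> S \<Longrightarrow> support_function K u * \<phi> u = 1"
  shows integrable_exp_wgauge: "integrable lborel (\<lambda>x. exp (- wgauge \<phi> x))"
    and integral_exp_wgauge: "(\<integral>x. exp (- wgauge \<phi> x) \<partial>lborel) = measure lebesgue K * fact DIM('a)"
proof -
  have [measurable]: "wgauge \<phi> \<in> borel_measurable borel" by (rule borel_measurable_wgauge[OF \<phi>(1)])
  note * = nn_integral_exp_wgauge[OF assms]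
  show "integrable lborel (\<lambda>x. exp (- wgauge \<phi> x))"
    by (rule integrableI_nn_integral_finite[OF _ _ *]) auto
  show "(\<integral>x. exp (- wgauge \<phi> x) \<partial>lborel) = measure lebesgue K * fact DIM('a)"
    by (rule integral_eq_nn_integral[THEN trans]) (auto simp: *)
qed

text \<open>\<open>c * g x\<close> is the gauge with constant weight \<open>c\<close>, which belongs
  to the body (1/c) L.\<close>

lemma integrable_exp_g:
  assumes "0 < c"
  shows "integrable lborel (\<lambda>x. exp (- (c * g x)))"
proof -
  have "wgauge (\<lambda>_. c) x = c * g x" for x
  proof -
    obtain u where u: "u \<in> S" "g x = x \<bullet> u"
      using wgauge_attained[of "\<lambda>_. 1" x] by auto
    have "wgauge (\<lambda>_. c) x \<le> c * g x"
      using wgauge_upper[of "\<lambda>_. 1" _ x] assms by (subst wgauge_le_iff) (auto simp: mult.commute intro!: mult_left_mono)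
    moreover have "c * g x \<le> wgauge (\<lambda>_. c) x"
      using wgauge_upper[of "\<lambda>_. c" u x] u by (simp add: mult.commute)
    ultimately show ?thesis by simp
  qed
  moreover have "integrable lborel (\<lambda>x. exp (- wgauge (\<lambda>_. c) x))"
  proof (rule integrable_exp_wgauge)
    show "convex_body ((*\<^sub>R) (1 / c) ` L)"
      using body by (auto simp: convex_body_def intro!: compact_scaling convex_scaling)
    show "0 \<in> (*\<^sub>R) (1 / c) ` L" using zero_mem by force
    show "support_function ((*\<^sub>R) (1 / c) ` L) u * c = 1" if "u \<in> S" for u
      using that assms by (subst support_function_scaleR_image[OF compact_L L_nonempty]) (auto simp: S_def)
  qed (use assms in auto)
  ultimately show ?thesis by simp
qed

text \<open>Half of the exponent absorbs the factor \<open>g x\<close>: the inequality y \<le> exp y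
  at y = c g(x) / 2 also yields the constant 2/c.\<close>

lemma integrable_g_exp_g:
  assumes "0 < c"
  shows "integrable lborel (\<lambda>x. g x * exp (- (c * g x)))"
proof (rule Bochner_Integration.integrable_bound)
  show "integrable lborel (\<lambda>x. (2 / c) * exp (- (c / 2 * g x)))"
    using assms by (intro integrable_mult_right integrable_exp_g) auto
  have [measurable]: "g \<in> borel_measurable borel" by (rule borel_measurable_wgauge) auto
  show "(\<lambda>x. g x * exp (- (c * g x))) \<in> borel_measurable lborel" by measurable
  show "AE x in lborel. norm (g x * exp (- (c * g x))) \<le> norm ((2 / c) * exp (- (c / 2 * g x)))"
  proof (rule AE_I2)
    fix x
    have nn: "0 \<le> g x" by (rule wgauge_nonneg) auto
    have "c / 2 * g x \<le> exp (c / 2 * g x)" using exp_ge_add_one_self[of "c / 2 * g x"] by linarith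
    then have "c / 2 * g x * exp (- (c * g x)) \<le> exp (c / 2 * g x) * exp (- (c * g x))"
      by (intro mult_right_mono) auto
    also have "\<dots> = exp (- (c / 2 * g x))" by (simp add: exp_add[symmetric])
    finally show "norm (g x * exp (- (c * g x))) \<le> norm ((2 / c) * exp (- (c / 2 * g x)))"
      using nn assms by (simp add: field_simps)
  qed
qed

text \<open>Envelope theorem at a unique maximiser: to first order in \<open>t\<close> only the
  change of the weight at \<open>u\<close> counts, because near-maximisers of the perturbed problem
  are drawn to \<open>u\<close>. Testing with \<open>u\<close> itself bounds the quotient from
  above; the bound from below needs uniqueness.\<close>

lemma wgauge_difference_quotient:
  assumes F: "continuous_on S F" "\<And>u. u \<in> S \<Longrightarrow> 0 \<le> F u" and p: "1 \<le> p"
    and x: "x \<noteq> 0" and u: "u \<in> S" "x \<bullet> u = g x"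
    and unique: "\<And>v. v \<in> S \<Longrightarrow> x \<bullet> v = g x \<Longrightarrow> v = u"
  shows "((\<lambda>t. (g x - wgauge (\<lambda>u. (1 + t * F u) powr (- 1 / p)) x) / t) \<longlongrightarrow> g x * F u / p) (at_right 0)"
proof (rule order_tendstoI)
  define G where "G t = wgauge (\<lambda>u. (1 + t * F u) powr (- 1 / p)) x" for t
  have cont: "continuous_on S (\<lambda>u. (1 + t * F u) powr (- 1 / p))" if "0 < t" for t
    using that F(2) by (intro continuous_intros F(1)) (smt (verit, best) mult_nonneg_nonneg)
  have gx: "0 < g x" using g_pos[OF x] .
  have slope: "((\<lambda>t. g x * ((1 - (1 + t * c) powr (- 1 / p)) / t)) \<longlongrightarrow> g x * (c / p)) (at_right 0)" for c
    using p by (intro tendsto_mult_left powr_one_plus_slope) auto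
  have pos: "\<forall>\<^sub>F t in at_right 0. 0 < (t::real)" by (rule eventually_at_right_less)
  {
    fix a assume "g x * F u / p < a"
    then have "\<forall>\<^sub>F t in at_right 0. g x * ((1 - (1 + t * F u) powr (- 1 / p)) / t) < a"
      using order_tendstoD(2)[OF slope[of "F u"]] by simp
    with pos have "\<forall>\<^sub>F t in at_right 0. (g x - G t) / t < a"
    proof eventually_elim
      case (elim t)
      have "g x * (1 + t * F u) powr (- 1 / p) \<le> G t"
        using wgauge_upper[OF cont[OF elim(1)] u(1), of x] u(2) by (simp add: G_def)
      then have "(g x - G t) / t \<le> g x * ((1 - (1 + t * F u) powr (- 1 / p)) / t)"
        using elim(1) by (simp add: field_simps)
      with elim show ?case by linarith
    qed
    then show "\<forall>\<^sub>F t in at_right 0. (g x - wgauge (\<lambda>u. (1 + t * F u) powr (- 1 / p)) x) / t < a"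
      by (simp add: G_def)
  next
    fix a assume a: "a < g x * F u / p"
    \<comment> \<open>The midpoint between \<open>F u\<close> and the solution c of g(x) c / p = a.
      It can be negative, so \<open>1 + t * c\<close> is claimed to be positive for small
      \<open>t\<close> only.\<close>
    define c where "c = (a * p / g x + F u) / 2"
    have c: "c < F u" "a < g x * (c / p)"
      using a gx p by (simp_all add: c_def field_simps)
    define T where "T = S \<inter> F -` {..c}"
    have "compact T"
      unfolding T_def using F(1) compact_S
      by (metis closed_atMost closedin_compact continuous_closedin_preimage)
    \<comment> \<open>By uniqueness the compact set \<open>T\<close>, which misses \<open>u\<close>,
      keeps the pairing with \<open>x\<close> below some \<open>m < g x\<close>; for small
      \<open>t\<close> its points stay below the value wanted for \<open>G t\<close>. Choosing
      \<open>m \<ge> 0\<close> lets it be multiplied by a weight at most 1.\<close>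
    obtain m where m: "0 \<le> m" "m < g x" "\<And>v. v \<in> T \<Longrightarrow> x \<bullet> v \<le> m"
    proof (cases "T = {}")
      case True then show ?thesis using gx that[of 0] by auto
    next
      case False
      have "continuous_on T (\<lambda>v. x \<bullet> v)" by (intro continuous_intros)
      then obtain w where w: "w \<in> T" "\<And>v. v \<in> T \<Longrightarrow> x \<bullet> v \<le> x \<bullet> w"
        using continuous_attains_sup[OF \<open>compact T\<close> False] by blast
      have "x \<bullet> w \<le> g x" using wgauge_upper[of "\<lambda>_. 1" w x] w by (auto simp: T_def)
      moreover have "x \<bullet> w \<noteq> g x" using unique[of w] w c by (auto simp: T_def)
      ultimately show ?thesis using w gx by (intro that[of "max 0 (x \<bullet> w)"]) (auto simp: le_max_iff_disj)
    qed
    have lim1: "((\<lambda>t. 1 + t * c) \<longlongrightarrow> 1) (at_right 0)"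
      by (auto intro!: tendsto_eq_intros)
    have "((\<lambda>t. g x * (1 + t * c) powr (- 1 / p)) \<longlongrightarrow> g x * 1 powr (- 1 / p)) (at_right 0)"
      by (intro tendsto_intros lim1) auto
    then have "\<forall>\<^sub>F t in at_right 0. m < g x * (1 + t * c) powr (- 1 / p)"
      using m by (intro order_tendstoD(1)) auto
    moreover have "\<forall>\<^sub>F t in at_right 0. 0 < 1 + t * c"
      using order_tendstoD(1)[OF lim1, of 0] by simp
    moreover have "\<forall>\<^sub>F t in at_right 0. a < g x * ((1 - (1 + t * c) powr (- 1 / p)) / t)"
      using order_tendstoD(1)[OF slope[of c] c(2)] by simp
    ultimately have "\<forall>\<^sub>F t in at_right 0. a < (g x - G t) / t"
      using pos
    proof eventually_elim
      case (elim t)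
      obtain v where v: "v \<in> S" "G t = (x \<bullet> v) * (1 + t * F v) powr (- 1 / p)"
        using wgauge_attained[OF cont[OF elim(4)]] by (metis G_def)
      have F0: "0 \<le> t * F v" using F(2)[OF v(1)] elim by simp
      have "G t \<le> g x * (1 + t * c) powr (- 1 / p)"
      proof (cases "v \<in> T")
        case True
        have "(1 + t * F v) powr (- 1 / p) \<le> 1 powr (- 1 / p)"
          using F0 p by (intro powr_mono2') auto
        then have "G t \<le> m * 1"
          unfolding v(2) using m True by (intro mult_mono) auto
        with elim show ?thesis by linarith
      next
        case False
        then have "c < F v" using v by (auto simp: T_def)
        then have *: "(1 + t * F v) powr (- 1 / p) \<le> (1 + t * c) powr (- 1 / p)"
          using elim p by (intro powr_mono2') auto
        have "x \<bullet> v \<le> g x" using wgauge_upper[of "\<lambda>_. 1" v x] v by auto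
        then show ?thesis
          unfolding v(2) using gx * by (intro mult_mono) auto
      qed
      then have "g x * ((1 - (1 + t * c) powr (- 1 / p)) / t) \<le> (g x - G t) / t"
        using elim by (simp add: field_simps)
      with elim show ?case by linarith
    qed
    then show "\<forall>\<^sub>F t in at_right 0. a < (g x - wgauge (\<lambda>u. (1 + t * F u) powr (- 1 / p)) x) / t"
      by (simp add: G_def)
  }
qed

text \<open>A maximiser of \<open>g\<close> is tested in the weighted supremum, with its weight
  bounded below through the upper bound \<open>B\<close> of \<open>F\<close>. The bound is uniform
  in the direction of \<open>x\<close>.\<close>

lemma wgauge_lower:
  assumes "continuous_on S F" "\<And>u. u \<in> S \<Longrightarrow> 0 \<le> F u" "\<And>u. u \<in> S \<Longrightarrow> F u \<le> B" "1 \<le> p" "0 \<le> t"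
  shows "g x * (1 + t * B) powr (- 1 / p) \<le> wgauge (\<lambda>u. (1 + t * F u) powr (- 1 / p)) x"
proof -
  have nn: "0 \<le> t * F u" if "u \<in> S" for u using assms(2)[OF that] assms(5) by simp
  have cont: "continuous_on S (\<lambda>u. (1 + t * F u) powr (- 1 / p))"
    using nn by (intro continuous_intros assms(1)) (smt (verit, best))
  obtain u where u: "u \<in> S" "g x = x \<bullet> u"
    using wgauge_attained[of "\<lambda>_. 1" x] by auto
  have "0 \<le> g x" by (rule wgauge_nonneg) auto
  moreover have "(1 + t * B) powr (- 1 / p) \<le> (1 + t * F u) powr (- 1 / p)"
    using assms nn[OF u(1)] u(1) by (intro powr_mono2') (auto intro: mult_left_mono add_pos_nonneg)
  ultimately have "g x * (1 + t * B) powr (- 1 / p) \<le> g x * (1 + t * F u) powr (- 1 / p)"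
    by (intro mult_left_mono)
  also have "\<dots> \<le> wgauge (\<lambda>u. (1 + t * F u) powr (- 1 / p)) x"
    using wgauge_upper[OF cont u(1), of x] u by simp
  finally show ?thesis .
qed

lemma wgauge_le_g:
  assumes "continuous_on S \<phi>" "\<And>u. u \<in> S \<Longrightarrow> 0 \<le> \<phi> u" "\<And>u. u \<in> S \<Longrightarrow> \<phi> u \<le> 1"
  shows "wgauge \<phi> x \<le> g x"
proof -
  obtain u where u: "u \<in> S" "wgauge \<phi> x = (x \<bullet> u) * \<phi> u"
    using wgauge_attained[OF assms(1)] by blast
  have "x \<bullet> u \<le> g x" using wgauge_upper[of "\<lambda>_. 1" u x] u by auto
  moreover have "0 \<le> g x" by (rule wgauge_nonneg) auto
  ultimately have "(x \<bullet> u) * \<phi> u \<le> g x * 1" using assms u by (intro mult_mono) auto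
  with u show ?thesis by simp
qed

text \<open>Dominated convergence on the pointwise derivative. The maximiser is an abstract almost
  everywhere choice \<open>w\<close>, entering through the measurable function
  \<open>F (w x)\<close>. The sequences of \<open>t\<close> are kept in (0,1), where the decay
  exp(-a g) is common to all perturbed gauges.\<close>

lemma integral_wgauge_derivative:
  assumes F: "continuous_on S F" "\<And>u. u \<in> S \<Longrightarrow> 0 \<le> F u" and p: "1 \<le> p"
    and w: "AE x in lborel. w x \<in> S \<and> x \<bullet> w x = g x \<and> (\<forall>v\<in>S. x \<bullet> v = g x \<longrightarrow> v = w x)"
    and meas [measurable]: "(\<lambda>x. F (w x)) \<in> borel_measurable borel"
  shows "integrable lborel (\<lambda>x. exp (- g x) * g x * F (w x))"
    and "((\<lambda>t. ((\<integral>x. exp (- wgauge (\<lambda>u. (1 + t * F u) powr (- 1 / p)) x) \<partial>lborel) - (\<integral>x. exp (- g x) \<partial>lborel)) / t)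
      \<longlongrightarrow> (\<integral>x. exp (- g x) * g x * F (w x) \<partial>lborel) / p) (at_right 0)"
proof -
  define G where "G t = wgauge (\<lambda>u. (1 + t * F u) powr (- 1 / p))" for t
  have "bounded (F ` S)"
    by (intro compact_imp_bounded compact_continuous_image compact_S F)
  then obtain B where B: "0 < B" "\<And>u. u \<in> S \<Longrightarrow> norm (F u) \<le> B"
    by (auto simp: bounded_pos)
  then have FB: "\<And>u. u \<in> S \<Longrightarrow> F u \<le> B" by fastforce
  have nn: "0 \<le> t * F u" if "u \<in> S" "0 < t" for u t using F(2)[OF that(1)] that by simp
  have cont: "continuous_on S (\<lambda>u. (1 + t * F u) powr (- 1 / p))" if "0 < t" for t
    using nn[OF _ that] by (intro continuous_intros F) (smt (verit, best))
  have le1: "(1 + t * F u) powr (- 1 / p) \<le> 1" if "0 < t" "u \<in> S" for t u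
  proof -
    have "(1 + t * F u) powr (- 1 / p) \<le> 1 powr (- 1 / p)"
      using nn[OF that(2,1)] p by (intro powr_mono2') auto
    then show ?thesis by simp
  qed
  have [measurable]: "g \<in> borel_measurable borel" by (rule borel_measurable_wgauge) auto
  have G_meas: "G t \<in> borel_measurable borel" if "0 < t" for t
    unfolding G_def by (rule borel_measurable_wgauge[OF cont[OF that]])
  have g0: "0 \<le> g x" for x by (rule wgauge_nonneg) auto
  have Gg: "G t x \<le> g x" if "0 < t" for t x
    unfolding G_def using that le1 cont by (intro wgauge_le_g) auto
  \<comment> \<open>A lower bound for all weights with \<open>t \<le> 1\<close>; it fixes an
    exponential decay rate that does not depend on \<open>t\<close>.\<close>
  define a where "a = (1 + B) powr (- 1 / p)"
  have a: "0 < a" using B by (simp add: a_def)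
  have G_ge: "a * g x \<le> G t x" if "0 < t" "t \<le> 1" for t x
  proof -
    have "a \<le> (1 + t * B) powr (- 1 / p)"
      unfolding a_def using that B p by (intro powr_mono2') (auto simp: add_pos_nonneg)
    then have "a * g x \<le> (1 + t * B) powr (- 1 / p) * g x"
      by (intro mult_right_mono g0)
    also have "\<dots> = g x * (1 + t * B) powr (- 1 / p)" by (rule mult.commute)
    also have "\<dots> \<le> G t x" unfolding G_def using that by (intro wgauge_lower F FB p) auto
    finally show ?thesis .
  qed
  have gG: "g x - G t x \<le> t * (B * g x)" if "0 < t" for t x
  proof -
    have "1 - t * B \<le> (1 + t * B) powr (- 1 / p)" using that B p by (intro one_plus_powr_ge) auto
    then have "g x * (1 - t * B) \<le> g x * (1 + t * B) powr (- 1 / p)"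
      by (intro mult_left_mono g0)
    also have "\<dots> \<le> G t x" unfolding G_def using that by (intro wgauge_lower F FB p) auto
    finally show ?thesis by (simp add: algebra_simps)
  qed
  have int_bound: "integrable lborel (\<lambda>x. B * (g x * exp (- (a * g x))))"
    by (intro integrable_mult_right integrable_g_exp_g a)
  have AEF: "AE x in lborel. 0 \<le> F (w x) \<and> F (w x) \<le> B"
    using w by eventually_elim (auto intro: F FB)
  show int: "integrable lborel (\<lambda>x. exp (- g x) * g x * F (w x))"
  proof (rule Bochner_Integration.integrable_bound)
    show "integrable lborel (\<lambda>x. B * (g x * exp (- (1 * g x))))"
      by (intro integrable_mult_right integrable_g_exp_g) auto
    show "AE x in lborel. norm (exp (- g x) * g x * F (w x)) \<le> norm (B * (g x * exp (- (1 * g x))))"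
      using AEF by eventually_elim (use g0 B in \<open>auto simp: abs_mult mult_ac intro!: mult_right_mono\<close>)
  qed measurable
  have "((\<lambda>t. (\<integral>x. (exp (- G t x) - exp (- g x)) / t \<partial>lborel)) \<longlongrightarrow> (\<integral>x. exp (- g x) * g x * F (w x) / p \<partial>lborel)) (at_right 0)"
  proof (rule tendsto_at_right_sequentially[of 0 1])
    fix t :: "nat \<Rightarrow> real" assume t: "\<And>n. 0 < t n" "\<And>n. t n < 1" "t \<longlonglongrightarrow> 0"
    have t0: "filterlim t (at_right 0) sequentially"
      using t by (intro filterlim_atI' tendsto_imp_filterlim_at_right) auto
    show "(\<lambda>n. (\<integral>x. (exp (- G (t n) x) - exp (- g x)) / t n \<partial>lborel)) \<longlonglongrightarrow> (\<integral>x. exp (- g x) * g x * F (w x) / p \<partial>lborel)"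
    proof (rule integral_dominated_convergence[OF _ _ int_bound])
      show "(\<lambda>x. exp (- g x) * g x * F (w x) / p) \<in> borel_measurable lborel" by measurable
      show "(\<lambda>x. (exp (- G (t n) x) - exp (- g x)) / t n) \<in> borel_measurable lborel" for n
        using G_meas[OF t(1)[of n]] by measurable
      show "AE x in lborel. norm ((exp (- G (t n) x) - exp (- g x)) / t n) \<le> B * (g x * exp (- (a * g x)))" for n
      proof (rule AE_I2)
        fix x
        \<comment> \<open>Factoring out the larger exponential leaves 1 - exp(G - g), which is at
          most g - G and hence linear in \<open>t n\<close>; the division by \<open>t n\<close> is
          then harmless.\<close>
        have "exp (- G (t n) x) - exp (- g x) = exp (- G (t n) x) * (1 - exp (G (t n) x - g x))"
          by (simp add: algebra_simps exp_add[symmetric])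
        also have "\<dots> \<le> exp (- (a * g x)) * (t n * (B * g x))"
        proof (intro mult_mono)
          show "1 - exp (G (t n) x - g x) \<le> t n * (B * g x)"
            using gG[OF t(1), of x n] exp_ge_add_one_self[of "G (t n) x - g x"] by linarith
          show "exp (- G (t n) x) \<le> exp (- (a * g x))" using G_ge[OF t(1), of n x] t(2)[of n] by simp
          show "0 \<le> 1 - exp (G (t n) x - g x)" using Gg[OF t(1), of n x] by simp
        qed simp
        finally have "(exp (- G (t n) x) - exp (- g x)) / t n \<le> B * (g x * exp (- (a * g x)))"
          using t(1)[of n] by (simp add: field_simps)
        moreover have "0 \<le> (exp (- G (t n) x) - exp (- g x)) / t n"
          using t(1)[of n] Gg[OF t(1), of n x] by simp
        ultimately show "norm ((exp (- G (t n) x) - exp (- g x)) / t n) \<le> B * (g x * exp (- (a * g x)))"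
          by simp
      qed
      have "AE x in lborel. x \<noteq> (0::'a)" by (rule AE_lborel_singleton)
      with w show "AE x in lborel. (\<lambda>n. (exp (- G (t n) x) - exp (- g x)) / t n) \<longlonglongrightarrow> exp (- g x) * g x * F (w x) / p"
      proof eventually_elim
        case (elim x)
        have lim: "((\<lambda>t. (g x - G t x) / t) \<longlongrightarrow> g x * F (w x) / p) (at_right 0)"
          unfolding G_def using elim by (intro wgauge_difference_quotient F p) auto
        \<comment> \<open>\<open>f\<close> follows \<open>G\<close> in its dependence on
          \<open>t\<close>, with value \<open>g x\<close> at 0. Reading the limit as a derivative
          within \<open>{0<..}\<close> lets the chain rule carry it through the exponential.\<close>
        define f where "f t = (if t = 0 then g x else G t x)" for t
        have "(f has_real_derivative - (g x * F (w x) / p)) (at 0 within {0<..})"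
          unfolding has_field_derivative_iff
        proof (rule Lim_transform_eventually[OF tendsto_minus[OF lim]])
          show "\<forall>\<^sub>F t in at_right 0. - ((g x - G t x) / t) = (f t - f 0) / (t - 0)"
            using eventually_at_right_less[of 0] by eventually_elim (simp add: f_def minus_divide_left)
        qed
        then have "((\<lambda>t. exp (- f t)) has_real_derivative exp (- f 0) * (g x * F (w x) / p)) (at 0 within {0<..})"
          by (auto intro!: derivative_eq_intros)
        then have "((\<lambda>t. (exp (- f t) - exp (- f 0)) / (t - 0)) \<longlongrightarrow> exp (- f 0) * (g x * F (w x) / p)) (at_right 0)"
          unfolding has_field_derivative_iff by simp
        from filterlim_compose[OF this t0]
        have "(\<lambda>n. (exp (- f (t n)) - exp (- f 0)) / (t n - 0)) \<longlonglongrightarrow> exp (- f 0) * (g x * F (w x) / p)" .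
        moreover have "t n \<noteq> 0" for n using t(1)[of n] by simp
        ultimately show ?case by (simp add: f_def mult.assoc)
      qed
    qed
  qed simp
  then have lim: "((\<lambda>t. (\<integral>x. (exp (- G t x) - exp (- g x)) / t \<partial>lborel)) \<longlongrightarrow> (\<integral>x. exp (- g x) * g x * F (w x) \<partial>lborel) / p) (at_right 0)"
    by simp
  show "((\<lambda>t. ((\<integral>x. exp (- wgauge (\<lambda>u. (1 + t * F u) powr (- 1 / p)) x) \<partial>lborel) - (\<integral>x. exp (- g x) \<partial>lborel)) / t)
      \<longlongrightarrow> (\<integral>x. exp (- g x) * g x * F (w x) \<partial>lborel) / p) (at_right 0)"
  proof (rule Lim_transform_eventually[OF lim])
    have "\<forall>\<^sub>F t in at_right 0. 0 < (t::real)" "\<forall>\<^sub>F t in at_right 0. (t::real) < 1"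
      by (auto intro: eventually_at_right_less eventually_at_rightI[of 0 1])
    then show "\<forall>\<^sub>F t in at_right 0. (\<integral>x. (exp (- G t x) - exp (- g x)) / t \<partial>lborel)
       = ((\<integral>x. exp (- wgauge (\<lambda>u. (1 + t * F u) powr (- 1 / p)) x) \<partial>lborel) - (\<integral>x. exp (- g x) \<partial>lborel)) / t"
    proof eventually_elim
      case (elim t)
      have "integrable lborel (\<lambda>x. exp (- G t x))"
      proof (rule Bochner_Integration.integrable_bound[OF integrable_exp_g[OF a]])
        show "(\<lambda>x. exp (- G t x)) \<in> borel_measurable lborel" using G_meas[OF elim(1)] by measurable
      qed (use G_ge elim in auto)
      moreover have "integrable lborel (\<lambda>x. exp (- g x))" using integrable_exp_g[of 1] by simp
      ultimately show ?case by (simp add: G_def)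
    qed
  qed
qed

end

section \<open>Almost everywhere uniqueness of outer normals\<close>

lemma integrable_compact_support:
  fixes f :: "'a::euclidean_space \<Rightarrow> real"
  assumes "continuous_on UNIV f" "\<And>x. r < norm x \<Longrightarrow> f x = 0"
  shows "integrable lborel f"
proof -
  have "integrable lborel (\<lambda>x. indicator (cball 0 r) x *\<^sub>R f x)"
    using assms(1) by (intro borel_integrable_compact) (auto intro: continuous_on_subset)
  moreover have "(\<lambda>x. indicator (cball 0 r) x *\<^sub>R f x) = f"
    using assms(2) by (auto simp: indicator_def fun_eq_iff not_le)
  ultimately show ?thesis by simp
qed

lemma lborel_integral_translate:
  fixes f :: "'a::euclidean_space \<Rightarrow> real"
  assumes "f \<in> borel_measurable borel"
  shows "(\<integral>x. f (x + c) \<partial>lborel) = (\<integral>x. f x \<partial>lborel)"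
proof -
  have "(\<integral>x. f x \<partial>lborel) = (\<integral>x. f x \<partial>distr lborel borel ((+) c))"
    by (simp add: lborel_distr_plus)
  also have "\<dots> = (\<integral>x. f (c + x) \<partial>lborel)"
    using assms by (intro integral_distr) auto
  finally show ?thesis by (simp add: add.commute)
qed

text \<open>Summation by parts: the second difference of \<open>f\<close> is traded for a product of first differences
  of \<open>f\<close> and of the cut-off, each of order \<open>\<delta>\<close>.\<close>

lemma integral_second_difference_le:
  fixes f :: "'a::euclidean_space \<Rightarrow> real"
  assumes f: "\<And>x y. \<bar>f x - f y\<bar> \<le> C * norm (x - y)" and C: "0 \<le> C"
    and b: "norm b = 1" and \<delta>: "0 < \<delta>" "\<delta> \<le> 1" and N: "0 \<le> N"
  shows "integrable lborel (\<lambda>x. max 0 (N - norm x) * (f (x + \<delta> *\<^sub>R b) + f (x - \<delta> *\<^sub>R b) - 2 * f x))"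
    and "(\<integral>x. max 0 (N - norm x) * (f (x + \<delta> *\<^sub>R b) + f (x - \<delta> *\<^sub>R b) - 2 * f x) \<partial>lborel)
      \<le> C * \<delta>\<^sup>2 * measure lborel (cball (0::'a) (N + 1))"
proof -
  define \<psi> where "\<psi> x = max 0 (N - norm x)" for x :: 'a
  define e where "e x = f (x + \<delta> *\<^sub>R b) - f x" for x
  have "C-lipschitz_on UNIV f" using f C by (intro lipschitz_onI) (auto simp: dist_norm)
  then have cf: "continuous_on UNIV f" by (rule lipschitz_on_continuous_on)
  have cf': "continuous_on UNIV (\<lambda>x. f (h x))" if "continuous_on UNIV h" for h :: "'a \<Rightarrow> 'a"
    by (rule continuous_on_compose2[OF cf that]) auto
  have ce: "continuous_on UNIV e" unfolding e_def by (intro continuous_intros cf')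
  have ce': "continuous_on UNIV (\<lambda>x. e (x - \<delta> *\<^sub>R b))"
    by (rule continuous_on_compose2[OF ce]) (auto intro!: continuous_intros)
  have c\<psi>: "continuous_on UNIV \<psi>" unfolding \<psi>_def by (intro continuous_intros)
  have c\<psi>': "continuous_on UNIV (\<lambda>x. \<psi> (x + \<delta> *\<^sub>R b))"
    by (rule continuous_on_compose2[OF c\<psi>]) (auto intro!: continuous_intros)
  have shift: "norm x \<le> norm (x + \<delta> *\<^sub>R b) + \<delta>" for x
    using norm_triangle_ineq4[of "x + \<delta> *\<^sub>R b" "\<delta> *\<^sub>R b"] b \<delta> by simp
  have iA: "integrable lborel (\<lambda>x. \<psi> x * e x)"
    by (rule integrable_compact_support[of _ N]) (auto intro!: continuous_intros c\<psi> ce simp: \<psi>_def)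
  have iB: "integrable lborel (\<lambda>x. \<psi> x * e (x - \<delta> *\<^sub>R b))"
    by (rule integrable_compact_support[of _ N]) (auto intro!: continuous_intros c\<psi> ce' simp: \<psi>_def)
  \<comment> \<open>The shift moves the support of the cut-off by at most \<delta> \<le> 1, hence
    the radius \<open>N + 1\<close> in the bound.\<close>
  have \<psi>'0: "\<psi> (x + \<delta> *\<^sub>R b) = 0" if "N + 1 < norm x" for x
    using shift[of x] that \<delta> by (simp add: \<psi>_def)
  have iB': "integrable lborel (\<lambda>x. \<psi> (x + \<delta> *\<^sub>R b) * e x)"
    by (rule integrable_compact_support[of _ "N + 1"]) (auto intro!: continuous_intros c\<psi>' ce simp: \<psi>'0)
  have eq: "max 0 (N - norm x) * (f (x + \<delta> *\<^sub>R b) + f (x - \<delta> *\<^sub>R b) - 2 * f x)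
    = \<psi> x * e x - \<psi> x * e (x - \<delta> *\<^sub>R b)" for x
    by (simp add: \<psi>_def e_def algebra_simps)
  show "integrable lborel (\<lambda>x. max 0 (N - norm x) * (f (x + \<delta> *\<^sub>R b) + f (x - \<delta> *\<^sub>R b) - 2 * f x))"
    unfolding eq using iA iB by simp
  \<comment> \<open>The summation by parts is translation invariance of Lebesgue measure, which
    moves the shift by \<open>\<delta> *\<^sub>R b\<close> from \<open>e\<close> to the
    cut-off.\<close>
  have B_eq: "(\<integral>x. \<psi> x * e (x - \<delta> *\<^sub>R b) \<partial>lborel) = (\<integral>x. \<psi> (x + \<delta> *\<^sub>R b) * e x \<partial>lborel)"
    using lborel_integral_translate[of "\<lambda>x. \<psi> x * e (x - \<delta> *\<^sub>R b)" "\<delta> *\<^sub>R b"]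
    by (simp add: borel_measurable_continuous_onI continuous_on_mult c\<psi> ce')
  have "(\<integral>x. max 0 (N - norm x) * (f (x + \<delta> *\<^sub>R b) + f (x - \<delta> *\<^sub>R b) - 2 * f x) \<partial>lborel)
    = (\<integral>x. \<psi> x * e x - \<psi> (x + \<delta> *\<^sub>R b) * e x \<partial>lborel)"
    unfolding eq using iA iB iB' B_eq by simp
  also have "\<dots> \<le> (\<integral>x. C * \<delta>\<^sup>2 * indicator (cball (0::'a) (N + 1)) x \<partial>lborel)"
  proof (rule Bochner_Integration.integral_mono)
    show "integrable lborel (\<lambda>x. \<psi> x * e x - \<psi> (x + \<delta> *\<^sub>R b) * e x)" using iA iB' by simp
    show "integrable lborel (\<lambda>x::'a. C * \<delta>\<^sup>2 * indicator (cball 0 (N + 1)) x)"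
      by (intro integrable_mult_right integrable_real_indicator emeasure_lborel_cball_finite) auto
    fix x :: 'a
    show "\<psi> x * e x - \<psi> (x + \<delta> *\<^sub>R b) * e x \<le> C * \<delta>\<^sup>2 * indicator (cball 0 (N + 1)) x"
    proof (cases "norm x \<le> N + 1")
      case True
      have "\<bar>e x\<bar> \<le> C * \<delta>" using f[of "x + \<delta> *\<^sub>R b" x] b \<delta> by (simp add: e_def)
      moreover have "\<bar>\<psi> x - \<psi> (x + \<delta> *\<^sub>R b)\<bar> \<le> \<delta>"
        using shift[of x] norm_triangle_ineq[of x "\<delta> *\<^sub>R b"] b \<delta> by (auto simp: \<psi>_def)
      ultimately have "\<bar>\<psi> x - \<psi> (x + \<delta> *\<^sub>R b)\<bar> * \<bar>e x\<bar> \<le> \<delta> * (C * \<delta>)"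
        using \<delta> by (intro mult_mono) auto
      then have "(\<psi> x - \<psi> (x + \<delta> *\<^sub>R b)) * e x \<le> \<delta> * (C * \<delta>)"
        by (metis abs_ge_self abs_mult order_trans)
      then show ?thesis using True by (simp add: algebra_simps power2_eq_square)
    next
      case False
      then show ?thesis using \<psi>'0[of x] by (simp add: \<psi>_def)
    qed
  qed
  also have "\<dots> = C * \<delta>\<^sup>2 * measure lborel (cball (0::'a) (N + 1))" by simp
  finally show "(\<integral>x. max 0 (N - norm x) * (f (x + \<delta> *\<^sub>R b) + f (x - \<delta> *\<^sub>R b) - 2 * f x) \<partial>lborel)
      \<le> C * \<delta>\<^sup>2 * measure lborel (cball (0::'a) (N + 1))" .
qed

text \<open>With \<delta> = 1/(n+1), the second difference divided by \<delta> has integral at most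
  K/(n+1) against a fixed cut-off. Its infimum over \<open>n\<close> thus integrates to 0 and, being
  nonnegative by the convexity hypothesis, vanishes almost everywhere. Working with the infimum
  avoids any claim that the quotients converge.\<close>

lemma AE_second_difference_small:
  fixes f :: "'a::euclidean_space \<Rightarrow> real"
  assumes f: "\<And>x y. \<bar>f x - f y\<bar> \<le> C * norm (x - y)" and C: "0 \<le> C" and b: "norm b = 1"
    and nonneg: "\<And>x v. 0 \<le> f (x + v) + f (x - v) - 2 * f x"
  shows "AE x in lborel. \<forall>\<epsilon>>0. \<exists>n. (f (x + (1 / real (Suc n)) *\<^sub>R b) + f (x - (1 / real (Suc n)) *\<^sub>R b) - 2 * f x) * real (Suc n) < \<epsilon>"
proof -
  define D where "D n x = (f (x + (1 / real (Suc n)) *\<^sub>R b) + f (x - (1 / real (Suc n)) *\<^sub>R b) - 2 * f x) * real (Suc n)" for n x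
  have D0: "0 \<le> D n x" for n x unfolding D_def using nonneg by (intro mult_nonneg_nonneg) auto
  have "C-lipschitz_on UNIV f" using f C by (intro lipschitz_onI) (auto simp: dist_norm)
  then have cf: "continuous_on UNIV f" by (rule lipschitz_on_continuous_on)
  then have [measurable]: "f \<in> borel_measurable borel" by (rule borel_measurable_continuous_onI)
  have [measurable]: "D n \<in> borel_measurable borel" for n unfolding D_def by measurable
  have zero: "(\<integral>\<^sup>+x. ennreal (max 0 (real N - norm x)) * (INF n. ennreal (D n x)) \<partial>lborel) = 0" (is "?I = 0") for N :: nat
  proof -
    define K where "K = C * measure lborel (cball (0::'a) (real N + 1))"
    have le: "?I \<le> ennreal (K / real (Suc n))" for n
    proof -
      have int: "integrable lborel (\<lambda>x. max 0 (real N - norm x) * D n x)"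
        using integral_second_difference_le(1)[OF f C b, of "1 / real (Suc n)" "real N"]
        unfolding D_def by (simp add: mult.assoc[symmetric] del: of_nat_Suc)
      have "?I \<le> (\<integral>\<^sup>+x. ennreal (max 0 (real N - norm x) * D n x) \<partial>lborel)"
        by (intro nn_integral_mono) (auto simp: ennreal_mult' intro!: mult_left_mono INF_lower)
      also have "\<dots> = ennreal (\<integral>x. max 0 (real N - norm x) * D n x \<partial>lborel)"
        using D0 by (intro nn_integral_eq_integral int) auto
      also have "(\<integral>x. max 0 (real N - norm x) * D n x \<partial>lborel) = (\<integral>x. max 0 (real N - norm x) * (f (x + (1 / real (Suc n)) *\<^sub>R b) + f (x - (1 / real (Suc n)) *\<^sub>R b) - 2 * f x) \<partial>lborel) * real (Suc n)"
        unfolding D_def by (simp add: mult.assoc[symmetric] del: of_nat_Suc)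
      also have "\<dots> \<le> C * (1 / real (Suc n))\<^sup>2 * measure lborel (cball (0::'a) (real N + 1)) * real (Suc n)"
        by (intro mult_right_mono integral_second_difference_le(2)[OF f C b]) auto
      also have "\<dots> = K / real (Suc n)" by (simp add: K_def power2_eq_square del: of_nat_Suc)
      finally show ?thesis by (simp add: ennreal_leI)
    qed
    have "(\<lambda>n. ennreal (K / real (Suc n))) \<longlonglongrightarrow> ennreal 0"
      by (intro tendsto_ennrealI LIMSEQ_Suc lim_const_over_n)
    from LIMSEQ_le_const[OF this, of ?I] le have "?I \<le> ennreal 0" by auto
    then show ?thesis by simp
  qed
  have "AE x in lborel. \<forall>N::nat. ennreal (max 0 (real N - norm x)) * (INF n. ennreal (D n x)) = 0"
    unfolding AE_all_countable using zero by (subst (asm) nn_integral_0_iff_AE) auto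
  then show ?thesis
  proof eventually_elim
    case (elim x)
    \<comment> \<open>A cut-off with \<open>norm x < real N\<close> is positive at \<open>x\<close>,
      so the infimum itself must vanish there.\<close>
    obtain N :: nat where "norm x < real N" using reals_Archimedean2 by blast
    with elim[rule_format, of N] have inf0: "(INF n. ennreal (D n x)) = 0" by auto
    show ?case
    proof (intro allI impI)
      fix \<epsilon> :: real assume "0 < \<epsilon>"
      then have "(INF n. ennreal (D n x)) < ennreal \<epsilon>" using inf0 by simp
      then obtain n where "ennreal (D n x) < ennreal \<epsilon>" by (auto simp: INF_less_iff)
      then have "D n x < \<epsilon>" using D0 by (simp add: ennreal_less_iff)
      then show "\<exists>n. (f (x + (1 / real (Suc n)) *\<^sub>R b) + f (x - (1 / real (Suc n)) *\<^sub>R b) - 2 * f x) * real (Suc n) < \<epsilon>"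
        unfolding D_def by blast
    qed
  qed
qed

section \<open>Outer normals and the integral formula for the mixed volume\<close>

context pointed_body
begin

text \<open>Almost everywhere this is the gradient of the gauge function, that is, the outer normal of \<open>L\<close>
  in direction \<open>x\<close>, normalised by \<open>h u = 1\<close>.\<close>

definition normal :: "'a \<Rightarrow> 'a" where
  "normal x = (\<Sum>b\<in>Basis. (INF n::nat. (g (x + (1 / real (Suc n)) *\<^sub>R b) - g x) * real (Suc n)) *\<^sub>R b)"

text \<open>A countable infimum of difference quotients is Borel on the whole space; it takes the
  place of a measurable selection among the maximisers.\<close>

lemma borel_measurable_normal [measurable]: "normal \<in> borel_measurable borel"
proof -
  have [measurable]: "g \<in> borel_measurable borel" by (rule borel_measurable_wgauge) auto
  show ?thesis unfolding normal_def by measurable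
qed

text \<open>Every maximiser is a subgradient of \<open>g\<close> at \<open>x\<close>, so its
  coordinate along \<open>b\<close> lies between the left and the right difference quotients. Their
  gap is the scaled second difference, which at almost every \<open>x\<close> becomes arbitrarily
  small; all maximisers therefore share the coordinates given by the infimum of the right
  quotients.\<close>

lemma AE_normal:
  "AE x in lborel. normal x \<in> S \<and> x \<bullet> normal x = g x \<and> (\<forall>v\<in>S. x \<bullet> v = g x \<longrightarrow> v = normal x)"
proof -
  obtain C where C: "0 \<le> C" "\<And>x y. \<bar>g x - g y\<bar> \<le> C * norm (x - y)"
    using wgauge_lipschitz[of "\<lambda>_. 1"] by auto
  have g_ge: "x \<bullet> v \<le> g x" if "v \<in> S" for x v
    using wgauge_upper[of "\<lambda>_. 1" v x] that by auto
  have att: "\<exists>v\<in>S. g x = x \<bullet> v" for x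
    using wgauge_attained[of "\<lambda>_. 1" x] by auto
  have nonneg: "0 \<le> g (x + v) + g (x - v) - 2 * g x" for x v
  proof -
    obtain u where "u \<in> S" "g x = x \<bullet> u" using att by blast
    with g_ge[of u "x + v"] g_ge[of u "x - v"] show ?thesis by (simp add: inner_add_left inner_diff_left)
  qed
  have "AE x in lborel. \<forall>b\<in>Basis. \<forall>\<epsilon>>0. \<exists>n. (g (x + (1 / real (Suc n)) *\<^sub>R b) + g (x - (1 / real (Suc n)) *\<^sub>R b) - 2 * g x) * real (Suc n) < \<epsilon>"
    by (intro AE_finite_allI AE_second_difference_small[OF C(2,1) _ nonneg]) auto
  then show ?thesis
  proof eventually_elim
    case (elim x)
    have uniq: "v = normal x" if v: "v \<in> S" "x \<bullet> v = g x" for v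
    proof (rule euclidean_eqI)
      fix b :: 'a assume b: "b \<in> Basis"
      let ?q = "\<lambda>n. (g (x + (1 / real (Suc n)) *\<^sub>R b) - g x) * real (Suc n)"
      have lower: "v \<bullet> b \<le> ?q n" for n
        using g_ge[OF v(1), of "x + (1 / real (Suc n)) *\<^sub>R b"] v(2)
        by (simp add: inner_add_left inner_add_right field_simps inner_commute del: of_nat_Suc)
      have lower': "(g x - g (x - (1 / real (Suc n)) *\<^sub>R b)) * real (Suc n) \<le> v \<bullet> b" for n
        using g_ge[OF v(1), of "x - (1 / real (Suc n)) *\<^sub>R b"] v(2)
        by (simp add: inner_diff_left inner_diff_right field_simps inner_commute del: of_nat_Suc)
      have bdd: "bdd_below (range ?q)" by (rule bdd_belowI2) (rule lower)
      have "(INF n. ?q n) = v \<bullet> b"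
      proof (rule antisym)
        show "v \<bullet> b \<le> (INF n. ?q n)" by (intro cINF_greatest lower) auto
        show "(INF n. ?q n) \<le> v \<bullet> b"
        proof (rule field_le_epsilon)
          fix \<epsilon> :: real assume "0 < \<epsilon>"
          then obtain n where n: "(g (x + (1 / real (Suc n)) *\<^sub>R b) + g (x - (1 / real (Suc n)) *\<^sub>R b) - 2 * g x) * real (Suc n) < \<epsilon>"
            using elim b by blast
          have "(INF n. ?q n) \<le> ?q n" by (intro cINF_lower bdd) auto
          \<comment> \<open>The right quotient is the gap plus the left quotient, and the left one
            is at most \<open>v \<bullet> b\<close>.\<close>
          also have "\<dots> = (g (x + (1 / real (Suc n)) *\<^sub>R b) + g (x - (1 / real (Suc n)) *\<^sub>R b) - 2 * g x) * real (Suc n)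
             + (g x - g (x - (1 / real (Suc n)) *\<^sub>R b)) * real (Suc n)"
            by (simp add: ring_distribs del: of_nat_Suc)
          also have "\<dots> \<le> \<epsilon> + v \<bullet> b" using n lower'[of n] by linarith
          finally show "(INF n. ?q n) \<le> v \<bullet> b + \<epsilon>" by simp
        qed
      qed
      moreover have "normal x \<bullet> b = (INF n. ?q n)"
        unfolding normal_def using b by (subst inner_sum_left_Basis) auto
      ultimately show "v \<bullet> b = normal x \<bullet> b" by simp
    qed
    obtain v where "v \<in> S" "g x = x \<bullet> v" using att by blast
    with uniq show ?case by metis
  qed
qed

text \<open>On \<open>S\<close> the support function of \<open>L\<close> is 1, so that of the
  perturbed sum is (1 + t h(M,u)^p)^(1/p), the reciprocal of the weight in the perturbed gauge.
  Dividing the derivative of the exponential integral by d! gives that of the volume, and the p in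
  the definition cancels the 1/p of the derivative.\<close>

lemma Lp_mixed_volume_eq:
  assumes M: "convex_body M" "0 \<in> M" and p: "1 \<le> p"
  shows "integrable lborel (\<lambda>x. exp (- g x) * g x * support_function M (normal x) powr p)"
    and "Lp_mixed_volume p L M =
      (\<integral>x. exp (- g x) * g x * support_function M (normal x) powr p \<partial>lborel) / (real DIM('a) * fact DIM('a))"
proof -
  have cM: "compact M" "M \<noteq> {}" using M by (auto simp: convex_body_def)
  define F where "F u = support_function M u powr p" for u
  have hM: "0 \<le> support_function M u" for u using support_function_nonneg cM M by blast
  have cF: "continuous_on A F" for A
    unfolding F_def using p hM
    by (intro continuous_on_powr' continuous_on_support_function cM continuous_on_const) auto
  have F0: "0 \<le> F u" for u by (simp add: F_def)
  have meas: "(\<lambda>x. F (normal x)) \<in> borel_measurable borel"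
    using borel_measurable_continuous_onI[OF cF] by measurable
  note deriv = integral_wgauge_derivative[OF cF F0 p AE_normal meas]
  show "integrable lborel (\<lambda>x. exp (- g x) * g x * support_function M (normal x) powr p)"
    using deriv(1) by (simp add: F_def)
  have L_eq: "(\<integral>x. exp (- g x) \<partial>lborel) = measure lebesgue L * fact DIM('a)"
    by (rule integral_exp_wgauge) (auto simp: body zero_mem S_def)
  have K_eq: "(\<integral>x. exp (- wgauge (\<lambda>u. (1 + t * F u) powr (- 1 / p)) x) \<partial>lborel)
    = measure lebesgue (Lp_sum p L ((*\<^sub>R) (t powr (1 / p)) ` M)) * fact DIM('a)" if t: "0 < t" for t
  proof (rule integral_exp_wgauge)
    have tM: "convex_body ((*\<^sub>R) (t powr (1 / p)) ` M)" "0 \<in> (*\<^sub>R) (t powr (1 / p)) ` M"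
      using M by (auto simp: convex_body_def compact_scaling convex_scaling intro!: image_eqI[where x = 0])
    note K = Lp_sum_props[OF p body zero_mem tM]
    show "convex_body (Lp_sum p L ((*\<^sub>R) (t powr (1 / p)) ` M))" "0 \<in> Lp_sum p L ((*\<^sub>R) (t powr (1 / p)) ` M)"
      using K by auto
    have pos: "0 < 1 + t * F u" for u using t F0[of u] by (simp add: add_pos_nonneg)
    show "continuous_on S (\<lambda>u. (1 + t * F u) powr (- 1 / p))"
      using pos by (intro continuous_intros cF) (auto simp: less_imp_neq[THEN not_sym])
    show "0 < (1 + t * F u) powr (- 1 / p)" for u using pos[of u] by simp
    fix u assume u: "u \<in> S"
    let ?k = "support_function (Lp_sum p L ((*\<^sub>R) (t powr (1 / p)) ` M)) u"
    have "0 \<le> ?k" using K by (intro support_function_nonneg) (auto simp: convex_body_def)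
    moreover have "?k powr p = 1 + t * F u"
      using K(3)[of u] u t p hM[of u]
      by (simp add: support_function_scaleR_image[OF cM] S_def F_def powr_mult powr_powr)
    ultimately have "?k = (1 + t * F u) powr (1 / p)"
      using p by (metis div_self le_zero_eq powr_one powr_powr times_divide_eq_right mult.right_neutral not_one_le_zero)
    then show "?k * (1 + t * F u) powr (- 1 / p) = 1"
      using pos[of u] by (simp add: powr_add[symmetric])
  qed
  let ?V = "\<lambda>t. (measure lebesgue (Lp_sum p L ((*\<^sub>R) (t powr (1 / p)) ` M)) - measure lebesgue L) / t"
  let ?I = "\<integral>x. exp (- g x) * g x * F (normal x) \<partial>lborel"
  have "(?V \<longlongrightarrow> ?I / p / fact DIM('a)) (at_right 0)"
  proof (rule Lim_transform_eventually)
    show "((\<lambda>t. ((\<integral>x. exp (- wgauge (\<lambda>u. (1 + t * F u) powr (- 1 / p)) x) \<partial>lborel) - (\<integral>x. exp (- g x) \<partial>lborel)) / t / fact DIM('a))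
      \<longlongrightarrow> ?I / p / fact DIM('a)) (at_right 0)"
      by (intro tendsto_divide deriv(2) tendsto_const) auto
    show "\<forall>\<^sub>F t in at_right 0. ((\<integral>x. exp (- wgauge (\<lambda>u. (1 + t * F u) powr (- 1 / p)) x) \<partial>lborel) - (\<integral>x. exp (- g x) \<partial>lborel)) / t / fact DIM('a) = ?V t"
      using eventually_at_right_less[of 0]
    proof eventually_elim
      case (elim t)
      show ?case unfolding K_eq[OF elim] L_eq using elim by (simp add: field_simps)
    qed
  qed
  then have "Lim (at_right 0) ?V = ?I / p / fact DIM('a)"
    by (intro tendsto_Lim) auto
  then show "Lp_mixed_volume p L M =
      (\<integral>x. exp (- g x) * g x * support_function M (normal x) powr p \<partial>lborel) / (real DIM('a) * fact DIM('a))"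
    unfolding Lp_mixed_volume_def using p by (simp add: F_def)
qed

end

section \<open>The reflection principle\<close>

text \<open>The product density makes the coordinates independent centred normals, and
  \<open>Y \<omega> \<bullet> u\<close> is a linear combination of them, with variance \<sigma>^2
  times the sum of the squared coefficients.\<close>

lemma (in prob_space) distributed_inner_normal:
  fixes Y :: "'a \<Rightarrow> 'b::euclidean_space"
  assumes Y: "distributed M lborel Y (\<lambda>x. ennreal (\<Prod>b\<in>Basis. normal_density 0 \<sigma> (x \<bullet> b)))"
    and \<sigma>: "0 < \<sigma>" and u: "u \<noteq> 0"
  shows "distributed M lborel (\<lambda>\<omega>. Y \<omega> \<bullet> u) (normal_density 0 (\<sigma> * norm u))"
proof -
  have Ym [measurable]: "Y \<in> borel_measurable M"
    using distributed_measurable[OF Y] by simp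
  let ?N = "density lborel (normal_density 0 \<sigma>)"
  have N_total: "(\<integral>\<^sup>+x. ennreal (normal_density 0 \<sigma> x) \<partial>lborel) = 1"
    using prob_space.emeasure_space_1[OF prob_space_normal_density[OF \<sigma>, of 0]] by (simp add: emeasure_density)
  \<comment> \<open>Probabilities of boxes factorise by Tonelli over the coordinates. Marginals and
    independence are both read off from this identity.\<close>
  have joint: "emeasure M {\<omega>\<in>space M. \<forall>b\<in>Basis. Y \<omega> \<bullet> b \<in> A b} = (\<Prod>b\<in>Basis. emeasure ?N (A b))"
    if A: "\<And>b. b \<in> Basis \<Longrightarrow> A b \<in> sets borel" for A :: "'b \<Rightarrow> real set"
  proof -
    \<comment> \<open>Emptied off \<open>Basis\<close>, so that measurability holds for every
      index.\<close>
    define A' where "A' b = (if b \<in> Basis then A b else {})" for b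
    have A' [measurable]: "A' b \<in> sets borel" for b using A by (simp add: A'_def)
    have "emeasure M {\<omega>\<in>space M. \<forall>b\<in>Basis. Y \<omega> \<bullet> b \<in> A b} = emeasure M (Y -` {x. \<forall>b\<in>Basis. x \<bullet> b \<in> A' b} \<inter> space M)"
      by (rule arg_cong[where f = "emeasure M"]) (auto simp: A'_def)
    also have "\<dots> = (\<integral>\<^sup>+x. ennreal (\<Prod>b\<in>Basis. normal_density 0 \<sigma> (x \<bullet> b)) * indicator {x. \<forall>b\<in>Basis. x \<bullet> b \<in> A' b} x \<partial>lborel)"
      by (rule distributed_emeasure[OF Y]) measurable
    also have "\<dots> = (\<integral>\<^sup>+x. (\<Prod>b\<in>Basis. ennreal (normal_density 0 \<sigma> (x \<bullet> b)) * indicator (A' b) (x \<bullet> b)) \<partial>lborel)"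
    proof (intro nn_integral_cong)
      fix x :: 'b
      have "(\<Prod>b\<in>Basis. indicator (A' b) (x \<bullet> b)) = (indicator {x. \<forall>b\<in>Basis. x \<bullet> b \<in> A' b} x :: ennreal)"
        by (auto simp: indicator_def prod.neutral intro!: prod_zero)
      then show "ennreal (\<Prod>b\<in>Basis. normal_density 0 \<sigma> (x \<bullet> b)) * indicator {x. \<forall>b\<in>Basis. x \<bullet> b \<in> A' b} x
        = (\<Prod>b\<in>Basis. ennreal (normal_density 0 \<sigma> (x \<bullet> b)) * indicator (A' b) (x \<bullet> b))"
        by (simp add: prod.distrib prod_ennreal)
    qed
    also have "\<dots> = (\<Prod>b\<in>Basis. (\<integral>\<^sup>+x. ennreal (normal_density 0 \<sigma> x) * indicator (A' b) x \<partial>lborel))"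
      by (rule nn_integral_lborel_prod) auto
    also have "\<dots> = (\<Prod>b\<in>Basis. emeasure ?N (A b))"
      by (intro prod.cong refl) (simp add: emeasure_density A A'_def)
    finally show ?thesis .
  qed
  have N_UNIV: "emeasure ?N UNIV = 1" using N_total by (simp add: emeasure_density)
  have single: "emeasure M ((\<lambda>\<omega>. Y \<omega> \<bullet> b) -` A \<inter> space M) = emeasure ?N A"
    if b: "b \<in> Basis" and A: "A \<in> sets borel" for b A
  proof -
    have "emeasure M ((\<lambda>\<omega>. Y \<omega> \<bullet> b) -` A \<inter> space M) = emeasure M {\<omega>\<in>space M. \<forall>c\<in>Basis. Y \<omega> \<bullet> c \<in> (if c = b then A else UNIV)}"
      using b by (intro arg_cong[where f = "emeasure M"]) auto
    also have "\<dots> = (\<Prod>c\<in>Basis. emeasure ?N (if c = b then A else UNIV))"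
      using A by (intro joint) auto
    also have "\<dots> = (\<Prod>c\<in>Basis. if c = b then emeasure ?N A else 1)"
      by (intro prod.cong) (auto simp: N_UNIV)
    also have "\<dots> = emeasure ?N A" using b by simp
    finally show ?thesis .
  qed
  have distr: "distributed M lborel (\<lambda>\<omega>. Y \<omega> \<bullet> b) (normal_density 0 \<sigma>)" if "b \<in> Basis" for b
    unfolding distributed_def
  proof (intro conjI measure_eqI)
    fix A assume "A \<in> sets (distr M lborel (\<lambda>\<omega>. Y \<omega> \<bullet> b))"
    then have A: "A \<in> sets borel" by simp
    show "emeasure (distr M lborel (\<lambda>\<omega>. Y \<omega> \<bullet> b)) A = emeasure ?N A"
      using A that by (simp add: emeasure_distr single)
  qed auto
  have indep: "indep_vars (\<lambda>_. borel) (\<lambda>b \<omega>. Y \<omega> \<bullet> b) Basis"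
  proof (subst indep_vars_finite[where E = "\<lambda>_. sets borel"])
    show "\<forall>A\<in>(\<Pi> i\<in>Basis. sets borel). prob (\<Inter>j\<in>Basis. (\<lambda>\<omega>. Y \<omega> \<bullet> j) -` A j \<inter> space M)
      = (\<Prod>j\<in>Basis. prob ((\<lambda>\<omega>. Y \<omega> \<bullet> j) -` A j \<inter> space M))"
    proof
      fix A :: "'b \<Rightarrow> real set" assume A: "A \<in> (\<Pi> i\<in>Basis. sets borel)"
      have "ennreal (prob (\<Inter>j\<in>Basis. (\<lambda>\<omega>. Y \<omega> \<bullet> j) -` A j \<inter> space M)) = emeasure M {\<omega>\<in>space M. \<forall>b\<in>Basis. Y \<omega> \<bullet> b \<in> A b}"
        unfolding emeasure_eq_measure by (intro arg_cong[where f = "\<lambda>x. ennreal (prob x)"]) (auto simp: ex_in_conv)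
      also have "\<dots> = (\<Prod>b\<in>Basis. emeasure ?N (A b))" using A by (intro joint) auto
      also have "\<dots> = (\<Prod>b\<in>Basis. emeasure M ((\<lambda>\<omega>. Y \<omega> \<bullet> b) -` A b \<inter> space M))"
        using A by (intro prod.cong) (auto simp: single Pi_iff)
      also have "\<dots> = ennreal (\<Prod>b\<in>Basis. prob ((\<lambda>\<omega>. Y \<omega> \<bullet> b) -` A b \<inter> space M))"
        by (simp add: emeasure_eq_measure prod_ennreal)
      finally show "prob (\<Inter>j\<in>Basis. (\<lambda>\<omega>. Y \<omega> \<bullet> j) -` A j \<inter> space M) = (\<Prod>j\<in>Basis. prob ((\<lambda>\<omega>. Y \<omega> \<bullet> j) -` A j \<inter> space M))"
        by (simp add: prod_nonneg)
    qed
    show "sets borel = sigma_sets (space borel) (sets (borel :: real measure))"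
      by (metis sets.sigma_sets_eq)
    show "Int_stable (sets (borel :: real measure))" by (auto simp: Int_stable_def)
    show "space borel \<in> sets (borel :: real measure)" by (rule sets.top)
    show "sets (borel :: real measure) \<subseteq> Pow (space borel)" by (rule sets.space_closed)
    show "(\<lambda>\<omega>. Y \<omega> \<bullet> b) \<in> borel_measurable M" for b
      by (intro borel_measurable_inner Ym borel_measurable_const)
  qed simp_all
  \<comment> \<open>Coordinates with coefficient 0 would contribute degenerate normals without a
    density; they add nothing to the sum and are left out.\<close>
  let ?I = "{b\<in>Basis. u \<bullet> b \<noteq> 0}"
  have I: "?I \<noteq> {}"
  proof -
    have "\<exists>b\<in>Basis. u \<bullet> b \<noteq> 0" using u euclidean_all_zero_iff[of u] by blast
    then show ?thesis by blast
  qed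
  have "distributed M lborel (\<lambda>\<omega>. \<Sum>b\<in>?I. (u \<bullet> b) * (Y \<omega> \<bullet> b)) (normal_density (\<Sum>b\<in>?I. 0) (sqrt (\<Sum>b\<in>?I. (\<bar>u \<bullet> b\<bar> * \<sigma>)\<^sup>2)))"
  proof (rule sum_indep_normal)
    show "indep_vars (\<lambda>_. borel) (\<lambda>b \<omega>. (u \<bullet> b) * (Y \<omega> \<bullet> b)) ?I"
      by (rule indep_vars_compose2[OF indep_vars_subset[OF indep]]) auto
    show "distributed M lborel (\<lambda>\<omega>. (u \<bullet> b) * (Y \<omega> \<bullet> b)) (normal_density 0 (\<bar>u \<bullet> b\<bar> * \<sigma>))" if "b \<in> ?I" for b
      using normal_density_affine[OF distr \<sigma>, of b "u \<bullet> b" 0] that by simp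
  qed (use I \<sigma> in auto)
  moreover have "(\<Sum>b\<in>?I. (u \<bullet> b) * (Y \<omega> \<bullet> b)) = Y \<omega> \<bullet> u" for \<omega>
    unfolding euclidean_inner[of "Y \<omega>" u]
    by (intro sum.mono_neutral_cong_left) (auto simp: mult.commute)
  moreover have "sqrt (\<Sum>b\<in>?I. (\<bar>u \<bullet> b\<bar> * \<sigma>)\<^sup>2) = \<sigma> * norm u"
  proof -
    have "(\<Sum>b\<in>?I. (\<bar>u \<bullet> b\<bar> * \<sigma>)\<^sup>2) = (\<Sum>b\<in>Basis. (u \<bullet> b)\<^sup>2 * \<sigma>\<^sup>2)"
      by (intro sum.mono_neutral_cong_left) (auto simp: power_mult_distrib)
    also have "\<dots> = \<sigma>\<^sup>2 * (norm u)\<^sup>2"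
      unfolding power2_norm_eq_inner euclidean_inner[of u u] sum_distrib_left
      by (intro sum.cong refl) (simp only: power2_eq_square mult_ac)
    finally show ?thesis using \<sigma> by (simp add: real_sqrt_mult)
  qed
  ultimately show ?thesis by simp
qed

text \<open>For independent variables the joint law is the product of the marginal laws, and each
  marginal is unchanged by a change of sign. The signs are deterministic: a random passage time is
  handled by treating each of its values separately.\<close>

lemma (in prob_space) prob_sign_flip:
  fixes \<xi> :: "nat \<Rightarrow> 'a \<Rightarrow> real"
  assumes indep: "indep_vars (\<lambda>_. borel) \<xi> {..<n}" and n: "0 < n"
    and sym: "\<And>i. i < n \<Longrightarrow> distr M borel (\<lambda>\<omega>. - \<xi> i \<omega>) = distr M borel (\<xi> i)"
    and \<epsilon>: "\<And>i. i < n \<Longrightarrow> \<epsilon> i = 1 \<or> \<epsilon> i = (- 1::real)"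
    and P: "Measurable.pred (\<Pi>\<^sub>M i\<in>{..<n}. borel) P"
  shows "prob {\<omega>\<in>space M. P (\<lambda>i\<in>{..<n}. \<epsilon> i * \<xi> i \<omega>)} = prob {\<omega>\<in>space M. P (\<lambda>i\<in>{..<n}. \<xi> i \<omega>)}"
proof -
  have rv: "\<xi> i \<in> borel_measurable M" if "i \<in> {..<n}" for i
    using indep that by (auto simp: indep_vars_def2)
  let ?P = "\<Pi>\<^sub>M i\<in>{..<n}. (borel :: real measure)"
  have ne: "{..<n} \<noteq> {}" using n by auto
  have indep': "indep_vars (\<lambda>_. borel) (\<lambda>i \<omega>. \<epsilon> i * \<xi> i \<omega>) {..<n}"
    by (rule indep_vars_compose2[OF indep]) auto
  have "distr M ?P (\<lambda>\<omega>. \<lambda>i\<in>{..<n}. \<epsilon> i * \<xi> i \<omega>) = (\<Pi>\<^sub>M i\<in>{..<n}. distr M borel (\<lambda>\<omega>. \<epsilon> i * \<xi> i \<omega>))"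
    using indep' by (subst (asm) indep_vars_iff_distr_eq_PiM'[OF ne]) (auto intro!: borel_measurable_times rv)
  also have "\<dots> = (\<Pi>\<^sub>M i\<in>{..<n}. distr M borel (\<xi> i))"
  proof (intro PiM_cong refl)
    fix i assume "i \<in> {..<n}"
    then show "distr M borel (\<lambda>\<omega>. \<epsilon> i * \<xi> i \<omega>) = distr M borel (\<xi> i)"
      using \<epsilon>[of i] sym[of i] by auto
  qed
  also have "\<dots> = distr M ?P (\<lambda>\<omega>. \<lambda>i\<in>{..<n}. \<xi> i \<omega>)"
    using indep by (subst (asm) indep_vars_iff_distr_eq_PiM'[OF ne]) (auto intro: rv)
  finally have eq: "distr M ?P (\<lambda>\<omega>. \<lambda>i\<in>{..<n}. \<epsilon> i * \<xi> i \<omega>) = distr M ?P (\<lambda>\<omega>. \<lambda>i\<in>{..<n}. \<xi> i \<omega>)" .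
  have m1: "(\<lambda>\<omega>. \<lambda>i\<in>{..<n}. \<epsilon> i * \<xi> i \<omega>) \<in> measurable M ?P"
    by (intro measurable_restrict borel_measurable_times borel_measurable_const rv)
  have m2: "(\<lambda>\<omega>. \<lambda>i\<in>{..<n}. \<xi> i \<omega>) \<in> measurable M ?P"
    by (intro measurable_restrict rv)
  have B: "{f \<in> space ?P. P f} \<in> sets ?P" using P by (rule predE)
  have "prob ((\<lambda>\<omega>. \<lambda>i\<in>{..<n}. \<epsilon> i * \<xi> i \<omega>) -` {f \<in> space ?P. P f} \<inter> space M)
     = prob ((\<lambda>\<omega>. \<lambda>i\<in>{..<n}. \<xi> i \<omega>) -` {f \<in> space ?P. P f} \<inter> space M)"
    using arg_cong[OF eq, of "\<lambda>D. measure D {f \<in> space ?P. P f}"]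
    unfolding measure_distr[OF m1 B] measure_distr[OF m2 B] .
  moreover have "(\<lambda>\<omega>. \<lambda>i\<in>{..<n}. \<epsilon> i * \<xi> i \<omega>) -` {f \<in> space ?P. P f} \<inter> space M = {\<omega>\<in>space M. P (\<lambda>i\<in>{..<n}. \<epsilon> i * \<xi> i \<omega>)}"
    by (auto simp: space_PiM)
  moreover have "(\<lambda>\<omega>. \<lambda>i\<in>{..<n}. \<xi> i \<omega>) -` {f \<in> space ?P. P f} \<inter> space M = {\<omega>\<in>space M. P (\<lambda>i\<in>{..<n}. \<xi> i \<omega>)}"
    by (auto simp: space_PiM)
  ultimately show ?thesis by simp
qed

text \<open>Reflection at the first passage above \<open>a\<close>. The lower bound loses the event that the walk
  overshoots \<open>a\<close> by more than \<open>\<epsilon>\<close>, which requires a step larger than \<open>\<epsilon>\<close>.\<close>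

lemma (in prob_space) discrete_reflection:
  fixes \<xi> :: "nat \<Rightarrow> 'a \<Rightarrow> real"
  assumes indep: "indep_vars (\<lambda>_. borel) \<xi> {..<n}" and n: "0 < n"
    and rv [measurable]: "\<And>i. \<xi> i \<in> borel_measurable M"
    and sym: "\<And>i. i < n \<Longrightarrow> distr M borel (\<lambda>\<omega>. - \<xi> i \<omega>) = distr M borel (\<xi> i)"
    and a: "0 \<le> a" and \<epsilon>: "0 < \<epsilon>"
  defines "S \<equiv> \<lambda>k \<omega>. \<Sum>i<k. \<xi> i \<omega>"
  shows "prob {\<omega>\<in>space M. \<exists>k\<le>n. a < S k \<omega>} \<le> 2 * prob {\<omega>\<in>space M. a < S n \<omega>}"
    and "prob {\<omega>\<in>space M. a < S n \<omega>} + prob {\<omega>\<in>space M. a + 2 * \<epsilon> < S n \<omega>}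
      \<le> prob {\<omega>\<in>space M. \<exists>k\<le>n. a < S k \<omega>} + prob {\<omega>\<in>space M. \<exists>i<n. \<epsilon> < \<xi> i \<omega>}"
proof -
  have Sm [measurable]: "S k \<in> borel_measurable M" for k
    unfolding S_def by measurable
  define first where "first k \<omega> \<longleftrightarrow> a < S k \<omega> \<and> (\<forall>j<k. S j \<omega> \<le> a)" for k \<omega>
  have first_m [measurable]: "Measurable.pred M (first k)" for k
    unfolding first_def by measurable
  \<comment> \<open>Flipping all steps from index \<open>k\<close> on leaves the walk unchanged up
    to time \<open>k\<close>, hence also the event \<open>first k \<omega>\<close>, and turns
    \<open>S n \<omega>\<close> into \<open>2 * S k \<omega> - S n \<omega>\<close>.\<close>
  have reflect: "prob {\<omega>\<in>space M. first k \<omega> \<and> S n \<omega> \<le> a} = prob {\<omega>\<in>space M. first k \<omega> \<and> 2 * S k \<omega> - S n \<omega> \<le> a}"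
    if k: "k \<le> n" for k
  proof -
    \<comment> \<open>Truncation at \<open>n\<close> keeps every \<open>T j\<close> a measurable
      function on the product over \<open>{..<n}\<close>.\<close>
    define T where "T j f = (\<Sum>i<min j n. f i)" for j and f :: "nat \<Rightarrow> real"
    define P where "P f \<longleftrightarrow> a < T k f \<and> (\<forall>j<k. T j f \<le> a) \<and> T n f \<le> a" for f :: "nat \<Rightarrow> real"
    define \<sigma> where "\<sigma> i = (if i < k then 1 else - 1 :: real)" for i
    have [measurable]: "T j \<in> borel_measurable (\<Pi>\<^sub>M i\<in>{..<n}. (borel :: real measure))" for j
      unfolding T_def by (intro borel_measurable_sum measurable_component_singleton) auto
    have "Measurable.pred (\<Pi>\<^sub>M i\<in>{..<n}. borel) P"
      unfolding P_def by measurable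
    then have "prob {\<omega>\<in>space M. P (\<lambda>i\<in>{..<n}. \<sigma> i * \<xi> i \<omega>)} = prob {\<omega>\<in>space M. P (\<lambda>i\<in>{..<n}. \<xi> i \<omega>)}"
      by (intro prob_sign_flip indep n sym) (auto simp: \<sigma>_def)
    moreover have "P (\<lambda>i\<in>{..<n}. \<xi> i \<omega>) \<longleftrightarrow> first k \<omega> \<and> S n \<omega> \<le> a" for \<omega>
      using k by (auto simp: P_def T_def first_def S_def min_def)
    moreover have "P (\<lambda>i\<in>{..<n}. \<sigma> i * \<xi> i \<omega>) \<longleftrightarrow> first k \<omega> \<and> 2 * S k \<omega> - S n \<omega> \<le> a" for \<omega>
    proof -
      have 1: "(\<Sum>i<j. (\<lambda>i\<in>{..<n}. \<sigma> i * \<xi> i \<omega>) i) = S j \<omega>" if "j \<le> k" for j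
        unfolding S_def using that k by (intro sum.cong) (auto simp: \<sigma>_def)
      have T1: "T j (\<lambda>i\<in>{..<n}. \<sigma> i * \<xi> i \<omega>) = S j \<omega>" if "j \<le> k" for j
        using 1[OF that] that k unfolding T_def by (simp add: min_absorb1)
      have "{..<n} = {..<k} \<union> {k..<n}" using k by auto
      then have split: "(\<Sum>i<n. f i) = (\<Sum>i<k. f i) + (\<Sum>i\<in>{k..<n}. f i)" for f :: "nat \<Rightarrow> real"
        by (metis finite_atLeastLessThan finite_lessThan ivl_disj_int_one(2) sum.union_disjoint)
      have "(\<Sum>i\<in>{k..<n}. (\<lambda>i\<in>{..<n}. \<sigma> i * \<xi> i \<omega>) i) = (\<Sum>i\<in>{k..<n}. - \<xi> i \<omega>)"
        by (intro sum.cong) (auto simp: \<sigma>_def)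
      then have 2: "T n (\<lambda>i\<in>{..<n}. \<sigma> i * \<xi> i \<omega>) = 2 * S k \<omega> - S n \<omega>"
        using split[of "\<lambda>i\<in>{..<n}. \<sigma> i * \<xi> i \<omega>"] split[of "\<lambda>i. \<xi> i \<omega>"] 1[of k]
        by (simp add: T_def S_def sum_negf)
      show ?thesis unfolding P_def first_def 2 using T1 by auto
    qed
    ultimately show ?thesis by simp
  qed
  have disj: "disjoint_family_on (\<lambda>k. {\<omega>\<in>space M. first k \<omega> \<and> Q k \<omega>}) {..n}" for Q
    unfolding disjoint_family_on_def first_def
    by (auto simp: disjoint_iff) (metis linorder_neqE_nat not_le)
  have ex_first: "(\<exists>k\<le>n. a < S k \<omega>) \<longleftrightarrow> (\<exists>k\<le>n. first k \<omega>)" for \<omega>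
  proof
    assume "\<exists>k\<le>n. a < S k \<omega>"
    then obtain k where k: "k \<le> n" "a < S k \<omega>" by blast
    let ?k = "LEAST k. a < S k \<omega>"
    have "first ?k \<omega>" unfolding first_def using k by (metis LeastI not_le not_less_Least)
    moreover have "?k \<le> n" using k by (meson Least_le order_trans)
    ultimately show "\<exists>k\<le>n. first k \<omega>" by blast
  qed (auto simp: first_def)
  \<comment> \<open>Paths that cross \<open>a\<close> and whose reflection at the first crossing
    ends at or below \<open>a\<close>; they turn out to be as likely as the crossing paths that end
    there themselves.\<close>
  define R where "R = {\<omega>\<in>space M. \<exists>k\<le>n. first k \<omega> \<and> 2 * S k \<omega> - S n \<omega> \<le> a}"
  have Rm [measurable]: "R \<in> sets M" unfolding R_def by measurable
  have "prob {\<omega>\<in>space M. (\<exists>k\<le>n. a < S k \<omega>) \<and> S n \<omega> \<le> a} = prob (\<Union>k\<in>{..n}. {\<omega>\<in>space M. first k \<omega> \<and> S n \<omega> \<le> a})"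
    by (rule arg_cong[where f = prob]) (auto simp: ex_first)
  also have "\<dots> = (\<Sum>k\<le>n. prob {\<omega>\<in>space M. first k \<omega> \<and> S n \<omega> \<le> a})"
    by (intro finite_measure_finite_Union disj) (auto intro!: sets.sets_Collect_conj simp: image_subset_iff)
  also have "\<dots> = (\<Sum>k\<le>n. prob {\<omega>\<in>space M. first k \<omega> \<and> 2 * S k \<omega> - S n \<omega> \<le> a})"
    by (intro sum.cong reflect) auto
  also have "\<dots> = prob (\<Union>k\<in>{..n}. {\<omega>\<in>space M. first k \<omega> \<and> 2 * S k \<omega> - S n \<omega> \<le> a})"
    by (intro finite_measure_finite_Union[symmetric] disj) (auto simp: image_subset_iff)
  also have "\<dots> = prob R"
    by (rule arg_cong[where f = prob]) (auto simp: R_def)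
  finally have R: "prob {\<omega>\<in>space M. (\<exists>k\<le>n. a < S k \<omega>) \<and> S n \<omega> \<le> a} = prob R" .
  have max_m [measurable]: "{\<omega>\<in>space M. \<exists>k\<le>n. a < S k \<omega>} \<in> sets M" by measurable
  have "prob {\<omega>\<in>space M. \<exists>k\<le>n. a < S k \<omega>}
    = prob ({\<omega>\<in>space M. a < S n \<omega>} \<union> {\<omega>\<in>space M. (\<exists>k\<le>n. a < S k \<omega>) \<and> S n \<omega> \<le> a})"
    by (rule arg_cong[where f = prob]) (auto simp: not_le)
  also have "\<dots> = prob {\<omega>\<in>space M. a < S n \<omega>} + prob {\<omega>\<in>space M. (\<exists>k\<le>n. a < S k \<omega>) \<and> S n \<omega> \<le> a}"
    using Sm[of n] max_m by (intro finite_measure_Union) (auto simp: Collect_conj_eq2)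
  finally have split: "prob {\<omega>\<in>space M. \<exists>k\<le>n. a < S k \<omega>} = prob {\<omega>\<in>space M. a < S n \<omega>} + prob R"
    using R by simp
  \<comment> \<open>From S k > a and 2 S k - S n \<le> a it follows that S n \<ge> 2 S k - a >
    a.\<close>
  have "R \<subseteq> {\<omega>\<in>space M. a < S n \<omega>}" by (auto simp: R_def first_def)
  then have "prob R \<le> prob {\<omega>\<in>space M. a < S n \<omega>}"
    using Sm[of n] by (intro finite_measure_mono) auto
  with split show "prob {\<omega>\<in>space M. \<exists>k\<le>n. a < S k \<omega>} \<le> 2 * prob {\<omega>\<in>space M. a < S n \<omega>}" by simp
  have big_m: "{\<omega>\<in>space M. \<exists>i<n. \<epsilon> < \<xi> i \<omega>} \<in> sets M"
    by measurable
  \<comment> \<open>If the overshoot at the passage is at most \<epsilon>, then 2 S k - S n < 2 (a +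
    \<epsilon>) - (a + 2 \<epsilon>) = a, which explains the 2 \<epsilon>. A larger overshoot needs
    a step above \<epsilon>, as the walk was at most \<open>a\<close> just before; passage at time 0
    is excluded by \<open>0 \<le> a\<close>.\<close>
  have "{\<omega>\<in>space M. a + 2 * \<epsilon> < S n \<omega>} \<subseteq> R \<union> {\<omega>\<in>space M. \<exists>i<n. \<epsilon> < \<xi> i \<omega>}"
  proof
    fix \<omega> assume "\<omega> \<in> {\<omega>\<in>space M. a + 2 * \<epsilon> < S n \<omega>}"
    then have \<omega>: "\<omega> \<in> space M" "a + 2 * \<epsilon> < S n \<omega>" by auto
    then have "a < S n \<omega>" using \<epsilon> by simp
    then obtain k where k: "k \<le> n" "first k \<omega>" using ex_first by blast
    show "\<omega> \<in> R \<union> {\<omega>\<in>space M. \<exists>i<n. \<epsilon> < \<xi> i \<omega>}"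
    proof (cases "S k \<omega> \<le> a + \<epsilon>")
      case True
      then show ?thesis using k \<omega> by (auto simp: R_def)
    next
      case False
      have "k \<noteq> 0" using k a by (auto simp: first_def S_def intro: Nat.gr0I)
      then obtain i where i: "k = Suc i" using not0_implies_Suc by blast
      then have "S i \<omega> \<le> a" using k by (auto simp: first_def)
      then have "\<epsilon> < \<xi> i \<omega>" using False by (simp add: i S_def)
      then show ?thesis using \<omega> k i by auto
    qed
  qed
  then have "prob {\<omega>\<in>space M. a + 2 * \<epsilon> < S n \<omega>} \<le> prob (R \<union> {\<omega>\<in>space M. \<exists>i<n. \<epsilon> < \<xi> i \<omega>})"
    using big_m by (intro finite_measure_mono) auto
  also have "\<dots> \<le> prob R + prob {\<omega>\<in>space M. \<exists>i<n. \<epsilon> < \<xi> i \<omega>}"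
    using big_m by (intro measure_subadditive) auto
  finally show "prob {\<omega>\<in>space M. a < S n \<omega>} + prob {\<omega>\<in>space M. a + 2 * \<epsilon> < S n \<omega>}
      \<le> prob {\<omega>\<in>space M. \<exists>k\<le>n. a < S k \<omega>} + prob {\<omega>\<in>space M. \<exists>i<n. \<epsilon> < \<xi> i \<omega>}"
    using split by simp
qed

section \<open>Passage from dyadic grids to continuous time\<close>

lemma (in prob_space) max_increment_tendsto_0:
  fixes B :: "real \<Rightarrow> 'a \<Rightarrow> real"
  assumes B: "\<And>t. 0 \<le> t \<Longrightarrow> B t \<in> borel_measurable M"
    and cont: "AE \<omega> in M. continuous_on {0..} (\<lambda>t. B t \<omega>)" and \<epsilon>: "0 < \<epsilon>"
  shows "(\<lambda>m. prob {\<omega>\<in>space M. \<exists>i<2 ^ m. \<epsilon> < B (real (Suc i) / 2 ^ m) \<omega> - B (real i / 2 ^ m) \<omega>}) \<longlonglongrightarrow> 0"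
proof -
  have [measurable]: "B (real k / 2 ^ m) \<in> borel_measurable M" for k m by (rule B) simp
  define J where "J m = {\<omega>\<in>space M. \<exists>i<2 ^ m. \<epsilon> < B (real (Suc i) / 2 ^ m) \<omega> - B (real i / 2 ^ m) \<omega>}" for m
  have Jm [measurable]: "J m \<in> sets M" for m unfolding J_def by measurable
  have "(\<lambda>m. (\<integral>\<omega>. indicator (J m) \<omega> \<partial>M)) \<longlonglongrightarrow> (\<integral>\<omega>. (0::real) \<partial>M)"
  proof (rule integral_dominated_convergence[where w = "\<lambda>_. 1"])
    show "AE \<omega> in M. (\<lambda>m. indicator (J m) \<omega> :: real) \<longlonglongrightarrow> 0"
      using cont
    proof eventually_elim
      case (elim \<omega>)
      \<comment> \<open>Uniform continuity rules out increments above \<epsilon> once the mesh is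
        small, so for almost every path the indicators vanish eventually.\<close>
      have "uniformly_continuous_on {0..1} (\<lambda>t. B t \<omega>)"
        using elim by (intro compact_uniformly_continuous) (auto intro: continuous_on_subset)
      then obtain d where d: "0 < d" "\<And>s t. s \<in> {0..1} \<Longrightarrow> t \<in> {0..1} \<Longrightarrow> dist t s < d \<Longrightarrow> dist (B t \<omega>) (B s \<omega>) < \<epsilon>"
        unfolding uniformly_continuous_on_def using \<epsilon> by metis
      have "(\<lambda>m. (1 / 2) ^ m :: real) \<longlonglongrightarrow> 0" by (rule LIMSEQ_power_zero) simp
      then have "\<forall>\<^sub>F m in sequentially. (1 / 2) ^ m < d" using d(1) by (rule order_tendstoD(2))
      then have "\<forall>\<^sub>F m in sequentially. indicator (J m) \<omega> = (0::real)"
      proof eventually_elim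
        case (elim m)
        have "\<not> \<epsilon> < B (real (Suc i) / 2 ^ m) \<omega> - B (real i / 2 ^ m) \<omega>" if i: "i < 2 ^ m" for i
        proof -
          have "real (Suc i) \<le> 2 ^ m" using i by (metis Suc_leI of_nat_le_iff of_nat_numeral of_nat_power)
          then have "dist (B (real (Suc i) / 2 ^ m) \<omega>) (B (real i / 2 ^ m) \<omega>) < \<epsilon>"
            using elim i by (intro d(2)) (auto simp: dist_real_def field_simps)
          then show ?thesis by (simp add: dist_real_def)
        qed
        then show ?case by (simp add: J_def)
      qed
      then show ?case by (rule tendsto_eventually)
    qed
  qed (auto simp: indicator_def)
  then have "(\<lambda>m. prob (J m)) \<longlonglongrightarrow> 0" by simp
  then show ?thesis by (simp only: J_def)
qed

text \<open>Running over all dyadic times makes the left event a countable union, measurable in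
  \<open>M\<close>. The grid walks bound its probability by 2 P(B 1 > a) from above and, up to the
  chance of a large step, by P(B 1 > a) + P(B 1 > a + 2 \<epsilon>) from below. For the lower bound
  the mesh tends to 0 at fixed \<epsilon>, and only then does \<epsilon>.\<close>

lemma (in prob_space) reflection_principle:
  fixes B :: "real \<Rightarrow> 'a \<Rightarrow> real"
  assumes B: "\<And>t. 0 \<le> t \<Longrightarrow> B t \<in> borel_measurable M"
    and indep: "\<And>m::nat. indep_vars (\<lambda>_. borel) (\<lambda>i \<omega>. B (real (Suc i) / 2 ^ m) \<omega> - B (real i / 2 ^ m) \<omega>) {..<2 ^ m}"
    and sym: "\<And>s t. 0 \<le> s \<Longrightarrow> s < t \<Longrightarrow> distr M borel (\<lambda>\<omega>. - (B t \<omega> - B s \<omega>)) = distr M borel (\<lambda>\<omega>. B t \<omega> - B s \<omega>)"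
    and start: "AE \<omega> in M. B 0 \<omega> = 0"
    and cont: "AE \<omega> in M. continuous_on {0..} (\<lambda>t. B t \<omega>)"
    and a: "0 \<le> a"
  shows "prob {\<omega>\<in>space M. \<exists>m. \<exists>k\<le>2 ^ m. a < B (real k / 2 ^ m) \<omega>} = 2 * prob {\<omega>\<in>space M. a < B 1 \<omega>}"
proof -
  have [measurable]: "B (real k / 2 ^ m) \<in> borel_measurable M" for k m by (rule B) simp
  have [measurable]: "B 1 \<in> borel_measurable M" "B 0 \<in> borel_measurable M" by (rule B, simp)+
  define E where "E m = {\<omega>\<in>space M. \<exists>k\<le>2 ^ m. a < B (real k / 2 ^ m) \<omega>}" for m
  define J where "J \<epsilon> m = {\<omega>\<in>space M. \<exists>i<2 ^ m. \<epsilon> < B (real (Suc i) / 2 ^ m) \<omega> - B (real i / 2 ^ m) \<omega>}" for \<epsilon> m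
  have Em [measurable]: "E m \<in> sets M" for m unfolding E_def by measurable
  define S where "S m k \<omega> = (\<Sum>i<k. B (real (Suc i) / 2 ^ m) \<omega> - B (real i / 2 ^ m) \<omega>)" for m k \<omega>
  have S: "S m k \<omega> = B (real k / 2 ^ m) \<omega> - B 0 \<omega>" for m k \<omega>
    unfolding S_def by (subst sum_lessThan_telescope) simp
  have [measurable]: "S m k \<in> borel_measurable M" for m k unfolding S_def by measurable
  have sym': "distr M borel (\<lambda>\<omega>. - (B (real (Suc i) / 2 ^ m) \<omega> - B (real i / 2 ^ m) \<omega>))
    = distr M borel (\<lambda>\<omega>. B (real (Suc i) / 2 ^ m) \<omega> - B (real i / 2 ^ m) \<omega>)" for i m
    by (rule sym) (auto simp: divide_strict_right_mono)
  have eqE: "prob {\<omega>\<in>space M. \<exists>k\<le>2 ^ m. a < S m k \<omega>} = prob (E m)" for m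
    unfolding E_def using start by (intro finite_measure_eq_AE) (auto simp: S)
  have eq1: "prob {\<omega>\<in>space M. c < S m (2 ^ m) \<omega>} = prob {\<omega>\<in>space M. c < B 1 \<omega>}" for c m
    using start by (intro finite_measure_eq_AE) (auto simp: S)
  have rv: "(\<lambda>\<omega>. B (real (Suc i) / 2 ^ m) \<omega> - B (real i / 2 ^ m) \<omega>) \<in> borel_measurable M" for i m
    by measurable
  have upper: "prob (E m) \<le> 2 * prob {\<omega>\<in>space M. a < B 1 \<omega>}" for m
    using discrete_reflection(1)[OF indep[of m] _ rv sym' a zero_less_one]
    unfolding S_def[symmetric] eqE eq1 by simp
  have lower: "prob {\<omega>\<in>space M. a < B 1 \<omega>} + prob {\<omega>\<in>space M. a + 2 * \<epsilon> < B 1 \<omega>} \<le> prob (E m) + prob (J \<epsilon> m)"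
    if "0 < \<epsilon>" for \<epsilon> m
    using discrete_reflection(2)[OF indep[of m] _ rv sym' a that]
    unfolding S_def[symmetric] eqE eq1 J_def by simp
  have "incseq E"
  proof (rule incseq_SucI)
    fix m show "E m \<le> E (Suc m)"
      unfolding E_def
    proof safe
      fix \<omega> k assume "k \<le> (2::nat) ^ m" "a < B (real k / 2 ^ m) \<omega>"
      \<comment> \<open>The time k / 2^m reappears as 2k / 2^(m+1), so the grids are nested.\<close>
      then have "2 * k \<le> 2 ^ Suc m \<and> a < B (real (2 * k) / 2 ^ Suc m) \<omega>" by simp
      then show "\<exists>k\<le>2 ^ Suc m. a < B (real k / 2 ^ Suc m) \<omega>" by blast
    qed
  qed
  then have limE: "(\<lambda>m. prob (E m)) \<longlonglongrightarrow> prob (\<Union>m. E m)"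
    by (intro finite_Lim_measure_incseq) auto
  have UN: "(\<Union>m. E m) = {\<omega>\<in>space M. \<exists>m. \<exists>k\<le>2 ^ m. a < B (real k / 2 ^ m) \<omega>}"
    by (auto simp: E_def)
  have le: "prob (\<Union>m. E m) \<le> 2 * prob {\<omega>\<in>space M. a < B 1 \<omega>}"
    using upper by (intro LIMSEQ_le_const2[OF limE]) auto
  have ge: "prob {\<omega>\<in>space M. a < B 1 \<omega>} + prob {\<omega>\<in>space M. a + 2 * \<epsilon> < B 1 \<omega>} \<le> prob (\<Union>m. E m)"
    if "0 < \<epsilon>" for \<epsilon>
  proof -
    have "(\<lambda>m. prob (E m) + prob (J \<epsilon> m)) \<longlonglongrightarrow> prob (\<Union>m. E m) + 0"
      unfolding J_def by (intro tendsto_add limE max_increment_tendsto_0 B cont that)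
    then show ?thesis using lower[OF that] by (intro LIMSEQ_le_const[where X = "\<lambda>m. prob (E m) + prob (J \<epsilon> m)"]) auto
  qed
  \<comment> \<open>Because the inequality is strict, these events increase to that of
    \<open>B 1\<close> exceeding \<open>a\<close>, and continuity from below lets \<epsilon> tend to
    0 along 1/(j+1).\<close>
  define A where "A j = {\<omega>\<in>space M. a + 2 * (1 / real (Suc j)) < B 1 \<omega>}" for j
  have [measurable]: "A j \<in> sets M" for j unfolding A_def by measurable
  have "incseq A"
  proof (rule incseq_SucI)
    fix j
    have "1 / real (Suc (Suc j)) \<le> 1 / real (Suc j)" by (intro divide_left_mono) auto
    then show "A j \<le> A (Suc j)" unfolding A_def by (auto simp del: of_nat_Suc)
  qed
  then have "(\<lambda>j. prob (A j)) \<longlonglongrightarrow> prob (\<Union>j. A j)"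
    by (intro finite_Lim_measure_incseq) auto
  moreover have "(\<Union>j. A j) = {\<omega>\<in>space M. a < B 1 \<omega>}"
  proof safe
    fix \<omega> assume \<omega>: "\<omega> \<in> space M" "a < B 1 \<omega>"
    then obtain j where "1 / real (Suc j) < (B 1 \<omega> - a) / 2"
      using nat_approx_posE[of "(B 1 \<omega> - a) / 2"] by auto
    then show "\<omega> \<in> (\<Union>j. A j)" using \<omega> by (auto simp: A_def field_simps simp del: of_nat_Suc intro!: exI[of _ j])
  next
    fix \<omega> j assume "\<omega> \<in> A j"
    moreover have "0 < 1 / real (Suc j)" by simp
    ultimately show "a < B 1 \<omega>" unfolding A_def mem_Collect_eq by linarith
  qed (auto simp: A_def)
  ultimately have "(\<lambda>j. prob {\<omega>\<in>space M. a < B 1 \<omega>} + prob (A j)) \<longlonglongrightarrow> prob {\<omega>\<in>space M. a < B 1 \<omega>} + prob {\<omega>\<in>space M. a < B 1 \<omega>}"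
    by (intro tendsto_add) auto
  moreover have "prob {\<omega>\<in>space M. a < B 1 \<omega>} + prob (A j) \<le> prob (\<Union>m. E m)" for j
    unfolding A_def by (rule ge) simp
  ultimately have "prob {\<omega>\<in>space M. a < B 1 \<omega>} + prob {\<omega>\<in>space M. a < B 1 \<omega>} \<le> prob (\<Union>m. E m)"
    by (intro LIMSEQ_le_const2[where X = "\<lambda>j. prob {\<omega>\<in>space M. a < B 1 \<omega>} + prob (A j)"]) auto
  with le show ?thesis unfolding UN by simp
qed

section \<open>Moments from tails and from the normal density\<close>

lemma (in prob_space) nn_integral_layer_cake:
  assumes [measurable]: "W \<in> borel_measurable M"
  shows "(\<integral>\<^sup>+\<omega>. W \<omega> \<partial>M) = (\<integral>\<^sup>+y. indicator {0..} y * emeasure M {\<omega>\<in>space M. ennreal y < W \<omega>} \<partial>lborel)"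
proof -
  interpret pair_sigma_finite lborel M ..
  have W: "W \<omega> = (\<integral>\<^sup>+y. indicator {y. 0 \<le> y \<and> ennreal y < W \<omega>} y \<partial>lborel)" for \<omega>
  proof (cases "W \<omega>")
    case (real w)
    then have "{y. 0 \<le> y \<and> ennreal y < W \<omega>} = {0..<w}" by (auto simp: ennreal_less_iff)
    then show ?thesis using real by simp
  next
    case top
    then have "{y. 0 \<le> y \<and> ennreal y < W \<omega>} = {0..}" by auto
    moreover have "emeasure lborel {0::real..} = \<infinity>"
    proof (rule ccontr)
      assume "emeasure lborel {0::real..} \<noteq> \<infinity>"
      then have "emeasure lborel {0::real..} < top" by (simp add: less_top)
      then obtain n :: nat where "emeasure lborel {0::real..} < of_nat n"
        using ennreal_Ex_less_of_nat by blast
      also have "of_nat n = emeasure lborel {0..real n}"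
        by (simp add: ennreal_of_nat_eq_real_of_nat)
      also have "\<dots> \<le> emeasure lborel {0::real..}"
        by (intro emeasure_mono) auto
      finally show False by simp
    qed
    ultimately show ?thesis using top by simp
  qed
  have "(\<integral>\<^sup>+\<omega>. W \<omega> \<partial>M) = (\<integral>\<^sup>+\<omega>. (\<integral>\<^sup>+y. indicator {y. 0 \<le> y \<and> ennreal y < W \<omega>} y \<partial>lborel) \<partial>M)"
    by (rule nn_integral_cong) (rule W)
  also have "\<dots> = (\<integral>\<^sup>+y. (\<integral>\<^sup>+\<omega>. indicator {y. 0 \<le> y \<and> ennreal y < W \<omega>} y \<partial>M) \<partial>lborel)"
    by (rule Fubini') measurable
  also have "\<dots> = (\<integral>\<^sup>+y. indicator {0..} y * emeasure M {\<omega>\<in>space M. ennreal y < W \<omega>} \<partial>lborel)"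
  proof (intro nn_integral_cong)
    fix y :: real
    have "(\<integral>\<^sup>+\<omega>. indicator {y. 0 \<le> y \<and> ennreal y < W \<omega>} y \<partial>M) =
      (\<integral>\<^sup>+\<omega>. indicator {0..} y * indicator {\<omega>\<in>space M. ennreal y < W \<omega>} \<omega> \<partial>M)"
      by (intro nn_integral_cong) (auto simp: indicator_def)
    also have "\<dots> = indicator {0..} y * emeasure M {\<omega>\<in>space M. ennreal y < W \<omega>}"
      by (rule nn_integral_cmult_indicator) measurable
    finally show "(\<integral>\<^sup>+\<omega>. indicator {y. 0 \<le> y \<and> ennreal y < W \<omega>} y \<partial>M) =
      indicator {0..} y * emeasure M {\<omega>\<in>space M. ennreal y < W \<omega>}" .
  qed
  finally show ?thesis .
qed

text \<open>The substitution t = x^2 / (2 \<sigma>^2) turns the integral over the positive half-line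
  into the Gamma integral with parameter (p+1)/2. The 2 in the denominator marks it as half of the
  absolute moment.\<close>

lemma normal_positive_part_moment:
  assumes \<sigma>: "0 < \<sigma>" and p: "1 \<le> p"
  shows "(\<integral>\<^sup>+x. ennreal (normal_density 0 \<sigma> x) * ennreal (max 0 x powr p) \<partial>lborel)
    = ennreal (\<sigma> powr p * 2 powr (p / 2) / (2 * sqrt pi) * Gamma ((p + 1) / 2))"
proof -
  define f where "f t = t powr ((p - 1) / 2) / exp t" for t :: real
  define q where "q x = x\<^sup>2 / (2 * \<sigma>\<^sup>2)" for x :: real
  define C where "C = \<sigma> powr p * 2 powr (p / 2) / (2 * sqrt pi)"
  have f_int: "(f has_integral Gamma ((p + 1) / 2)) {0..}"
  proof -
    have "(p + 1) / 2 - 1 = (p - 1) / 2" by (simp add: field_simps)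
    then show ?thesis
      using Gamma_integral_real[of "(p + 1) / 2"] p unfolding f_def by simp
  qed
  have q_image: "q ` {0..} = {0..}"
  proof safe
    fix y :: real assume "0 \<le> y"
    then show "y \<in> q ` {0..}"
      using \<sigma> by (intro image_eqI[where x = "sqrt (2 * \<sigma>\<^sup>2 * y)"]) (auto simp: q_def)
  qed (simp add: q_def)
  have "f absolutely_integrable_on {0..}"
    using f_int by (intro nonnegative_absolutely_integrable_1) (auto simp: f_def has_integral_iff)
  then have "f absolutely_integrable_on q ` {0..} \<and> integral (q ` {0..}) f = Gamma ((p + 1) / 2)"
    using f_int q_image by (simp add: integral_unique)
  moreover have "(q has_field_derivative x / \<sigma>\<^sup>2) (at x within {0..})" for x
    unfolding q_def using \<sigma> by (auto intro!: derivative_eq_intros simp: field_simps power2_eq_square)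
  moreover have "inj_on q {0..}"
    using \<sigma> by (auto simp: inj_on_def q_def)
  moreover have "{0::real..} \<in> sets lebesgue" by simp
  ultimately have "(\<lambda>x. \<bar>x / \<sigma>\<^sup>2\<bar> * f (q x)) absolutely_integrable_on {0..} \<and>
      integral {0..} (\<lambda>x. \<bar>x / \<sigma>\<^sup>2\<bar> * f (q x)) = Gamma ((p + 1) / 2)"
    using has_absolute_integral_change_of_variables_1'[of "{0..}" q "\<lambda>x. x / \<sigma>\<^sup>2" f "Gamma ((p + 1) / 2)"] by blast
  then have int: "((\<lambda>x. \<bar>x / \<sigma>\<^sup>2\<bar> * f (q x)) has_integral Gamma ((p + 1) / 2)) {0..}"
    by (metis set_lebesgue_integral_eq_integral(1) integrable_integral)
  have eq: "normal_density 0 \<sigma> x * x powr p = C * (\<bar>x / \<sigma>\<^sup>2\<bar> * f (q x))" if x: "0 \<le> x" for x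
  proof (cases "x = 0")
    case True then show ?thesis by simp
  next
    case False
    with x have x: "0 < x" by simp
    have "q x powr ((p - 1) / 2) = x powr (p - 1) / (2 powr ((p - 1) / 2) * \<sigma> powr (p - 1))"
    proof -
      have sq: "y\<^sup>2 powr ((p - 1) / 2) = y powr (p - 1)" if "0 < y" for y :: real
      proof -
        have "y\<^sup>2 = y powr 2" using that by simp
        moreover have "2 * ((p - 1) / 2) = p - 1" by simp
        ultimately show ?thesis by (simp only: powr_powr)
      qed
      show ?thesis unfolding q_def using x \<sigma> by (simp add: powr_divide powr_mult sq)
    qed
    then have 1: "\<bar>x / \<sigma>\<^sup>2\<bar> * f (q x) = x / \<sigma>\<^sup>2 * (x powr (p - 1) / (2 powr ((p - 1) / 2) * \<sigma> powr (p - 1))) * exp (- (x\<^sup>2 / (2 * \<sigma>\<^sup>2)))"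
      using x \<sigma> by (simp add: f_def q_def exp_minus field_simps)
    have 2: "x powr (p - 1) = x powr p / x" "\<sigma> powr (p - 1) = \<sigma> powr p / \<sigma>"
      using x \<sigma> by (simp_all add: powr_diff)
    have 3: "2 powr ((p - 1) / 2) = 2 powr (p / 2) / sqrt 2"
      by (simp add: diff_divide_distrib powr_diff powr_half_sqrt)
    have 4: "normal_density 0 \<sigma> x = exp (- (x\<^sup>2 / (2 * \<sigma>\<^sup>2))) / (sqrt 2 * sqrt pi * \<sigma>)"
      using \<sigma> by (simp add: normal_density_def real_sqrt_mult)
    show ?thesis
      unfolding 1 2 3 4 C_def using x \<sigma>
      by (simp add: field_simps power2_eq_square)
  qed
  have "(\<integral>\<^sup>+x. ennreal (normal_density 0 \<sigma> x) * ennreal (max 0 x powr p) \<partial>lborel)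
    = (\<integral>\<^sup>+x. ennreal (C * (\<bar>x / \<sigma>\<^sup>2\<bar> * f (q x))) * indicator {0..} x \<partial>lborel)"
  proof (intro nn_integral_cong)
    fix x :: real
    show "ennreal (normal_density 0 \<sigma> x) * ennreal (max 0 x powr p) = ennreal (C * (\<bar>x / \<sigma>\<^sup>2\<bar> * f (q x))) * indicator {0..} x"
    proof (cases "0 \<le> x")
      case True
      then show ?thesis by (simp add: eq max_absorb2 ennreal_mult'[symmetric])
    qed (auto simp: max_def)
  qed
  also have "\<dots> = ennreal (C * Gamma ((p + 1) / 2))"
    using \<sigma> by (intro nn_integral_has_integral_lebesgue' has_integral_mult_right int) (auto simp: C_def f_def)
  finally show ?thesis by (simp add: C_def)
qed

section \<open>Brownian convex hulls\<close>

text \<open>The union of the nested grids of the reflection argument. Suprema over this countable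
  set are measurable in the path, and for continuous paths they are the suprema over [0,1].\<close>

definition unit_dyadics :: "real set" where
  "unit_dyadics = (\<Union>m::nat. (\<lambda>k. real k / 2 ^ m) ` {..2 ^ m})"

lemma countable_unit_dyadics: "countable unit_dyadics"
  unfolding unit_dyadics_def by auto

lemma unit_dyadics_subset: "unit_dyadics \<subseteq> {0..1}"
proof
  fix t assume "t \<in> unit_dyadics"
  then obtain m k where t: "t = real k / 2 ^ m" "k \<le> 2 ^ m" by (auto simp: unit_dyadics_def)
  then have "real k \<le> 2 ^ m" by (metis of_nat_le_iff of_nat_numeral of_nat_power)
  then show "t \<in> {0..1}" unfolding t(1) by (simp add: divide_le_eq)
qed

lemma unit_dyadics_dense:
  assumes "t \<in> {0..1}"
  obtains q where "\<And>n::nat. q n \<in> unit_dyadics" "q \<longlonglongrightarrow> t"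
proof
  define k where "k n = nat \<lfloor>t * 2 ^ n\<rfloor>" for n :: nat
  have k: "real (k n) = of_int \<lfloor>t * 2 ^ n\<rfloor>" for n using assms by (simp add: k_def)
  show "real (k n) / 2 ^ n \<in> unit_dyadics" for n
  proof -
    have "t * 2 ^ n \<le> 2 ^ n" using assms by (simp add: mult_left_le_one_le)
    then have "real (k n) \<le> 2 ^ n" using k[of n] of_int_floor_le[of "t * 2 ^ n"] by linarith
    then have "k n \<le> 2 ^ n" by (metis of_nat_le_iff of_nat_numeral of_nat_power)
    then show ?thesis unfolding unit_dyadics_def by blast
  qed
  show "(\<lambda>n. real (k n) / 2 ^ n) \<longlonglongrightarrow> t"
  proof (rule tendsto_sandwich)
    have "t - (1 / 2) ^ n \<le> real (k n) / 2 ^ n \<and> real (k n) / 2 ^ n \<le> t" for n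
    proof -
      have "t * 2 ^ n - 1 \<le> real (k n)" "real (k n) \<le> t * 2 ^ n"
        using k[of n] floor_correct[of "t * 2 ^ n"] by linarith+
      then have "(t * 2 ^ n - 1) / 2 ^ n \<le> real (k n) / 2 ^ n" "real (k n) / 2 ^ n \<le> t * 2 ^ n / 2 ^ n"
        by (intro divide_right_mono; simp)+
      then show ?thesis by (simp add: diff_divide_distrib power_one_over)
    qed
    then show "\<forall>\<^sub>F n in sequentially. t - (1 / 2) ^ n \<le> real (k n) / 2 ^ n"
      "\<forall>\<^sub>F n in sequentially. real (k n) / 2 ^ n \<le> t" by auto
    have "(\<lambda>n. t - (1 / 2) ^ n) \<longlonglongrightarrow> t - 0"
      by (intro tendsto_intros LIMSEQ_power_zero) simp
    then show "(\<lambda>n. t - (1 / 2) ^ n) \<longlonglongrightarrow> t" by simp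
  qed simp
qed

text \<open>Truncation at 0 keeps \<open>powr\<close> away from negative arguments and does not
  change the supremum, since the maximum is at least \<open>f 0 = 0\<close>. Continuity and density
  of the dyadics supply values tending to it.\<close>

lemma SUP_unit_dyadics_powr:
  fixes f :: "real \<Rightarrow> real"
  assumes f: "continuous_on {0..1} f" and f0: "f 0 = 0" and t: "t \<in> {0..1}"
    and max: "\<And>s. s \<in> {0..1} \<Longrightarrow> f s \<le> f t" and p: "0 < p"
  shows "(SUP q\<in>unit_dyadics. ennreal (max 0 (f q) powr p)) = ennreal (f t powr p)"
proof (rule antisym)
  have ft: "0 \<le> f t" using max[of 0] f0 by simp
  show "(SUP q\<in>unit_dyadics. ennreal (max 0 (f q) powr p)) \<le> ennreal (f t powr p)"
  proof (rule SUP_least)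
    fix q assume "q \<in> unit_dyadics"
    then have "max 0 (f q) \<le> f t" using max[of q] ft unit_dyadics_subset by auto
    then show "ennreal (max 0 (f q) powr p) \<le> ennreal (f t powr p)"
      using p by (intro ennreal_leI powr_mono2) auto
  qed
  obtain q where q: "\<And>n::nat. q n \<in> unit_dyadics" "q \<longlonglongrightarrow> t"
    using unit_dyadics_dense[OF t] by blast
  have "(\<lambda>n. f (q n)) \<longlonglongrightarrow> f t"
    using q(1) unit_dyadics_subset
    by (intro continuous_on_tendsto_compose[OF f q(2) t] always_eventually allI) blast
  then have "(\<lambda>n. max 0 (f (q n)) powr p) \<longlonglongrightarrow> max 0 (f t) powr p"
    using p by (intro tendsto_powr' tendsto_max tendsto_const) auto
  then have "(\<lambda>n. ennreal (max 0 (f (q n)) powr p)) \<longlonglongrightarrow> ennreal (f t powr p)"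
    using ft by (intro tendsto_ennrealI) (simp add: max_absorb2)
  then show "ennreal (f t powr p) \<le> (SUP q\<in>unit_dyadics. ennreal (max 0 (f q) powr p))"
    by (rule LIMSEQ_le_const2) (auto intro!: SUP_upper q)
qed

lemma path_hull_convex_body:
  assumes cont: "continuous_on {0..1} (\<lambda>t. X t \<omega>)" and X0: "X 0 \<omega> = 0"
  shows "convex_body (path_hull X \<omega>)" "0 \<in> path_hull X \<omega>"
    "path_hull X \<omega> = convex hull ((\<lambda>t. X t \<omega>) ` {0..1})"
proof -
  have "compact (convex hull ((\<lambda>t. X t \<omega>) ` {0..1}))"
    by (intro compact_convex_hull compact_continuous_image cont) simp
  then show eq: "path_hull X \<omega> = convex hull ((\<lambda>t. X t \<omega>) ` {0..1})"
    unfolding path_hull_def by (intro closure_closed compact_imp_closed)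
  have "X 0 \<omega> \<in> (\<lambda>t. X t \<omega>) ` {0..1}" by (rule imageI) simp
  then show 0: "0 \<in> path_hull X \<omega>" unfolding eq X0 by (rule hull_inc)
  show "convex_body (path_hull X \<omega>)"
    using 0 \<open>compact (convex hull ((\<lambda>t. X t \<omega>) ` {0..1}))\<close>
    by (auto simp: convex_body_def eq)
qed

text \<open>Passing to the convex hull does not raise the maximum of a linear functional, so the
  support function is the maximum of the projected path. The right-hand side remains meaningful and
  measurable off the event of continuous paths.\<close>

lemma support_function_path_hull_powr:
  assumes cont: "continuous_on {0..1} (\<lambda>t. X t \<omega>)" and X0: "X 0 \<omega> = 0" and p: "0 < p"
  shows "ennreal (support_function (path_hull X \<omega>) u powr p) = (SUP q\<in>unit_dyadics. ennreal (max 0 (X q \<omega> \<bullet> u) powr p))"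
proof -
  have c: "continuous_on {0..1} (\<lambda>t. X t \<omega> \<bullet> u)" by (intro continuous_intros cont)
  obtain t where t: "t \<in> {0..1}" "\<And>s. s \<in> {0..1} \<Longrightarrow> X s \<omega> \<bullet> u \<le> X t \<omega> \<bullet> u"
    using continuous_attains_sup[OF _ _ c] by auto
  have "support_function (path_hull X \<omega>) u = X t \<omega> \<bullet> u"
    unfolding path_hull_convex_body(3)[of X \<omega>, OF cont X0]
  proof (rule support_function_eqI[OF _ hull_inc refl])
    show "X t \<omega> \<in> (\<lambda>t. X t \<omega>) ` {0..1}" using t(1) by (rule imageI)
    fix x assume x: "x \<in> convex hull ((\<lambda>t. X t \<omega>) ` {0..1})"
    have "convex hull ((\<lambda>t. X t \<omega>) ` {0..1}) \<subseteq> {x. u \<bullet> x \<le> X t \<omega> \<bullet> u}"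
      using t(2) by (intro hull_minimal convex_halfspace_le) (auto simp: inner_commute)
    with x show "x \<bullet> u \<le> X t \<omega> \<bullet> u" by (auto simp: inner_commute)
  qed
  then show ?thesis
    using SUP_unit_dyadics_powr[OF c _ t p] X0 by simp
qed

lemma less_positive_part_powr_iff:
  fixes x y p :: real
  assumes "0 \<le> y" "0 < p"
  shows "y < max 0 x powr p \<longleftrightarrow> y powr (1 / p) < x"
proof
  assume *: "y < max 0 x powr p"
  then have "0 < x" using assms by (cases "0 < x") (auto simp: max_def split: if_splits)
  with * have "y powr (1 / p) < (x powr p) powr (1 / p)"
    using assms by (intro powr_less_mono2) auto
  then show "y powr (1 / p) < x" using \<open>0 < x\<close> assms by (simp add: powr_powr)
next
  assume *: "y powr (1 / p) < x"
  then have "(y powr (1 / p)) powr p < x powr p"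
    using assms by (intro powr_less_mono2) auto
  moreover have "0 < x" using * powr_ge_zero[of y "1 / p"] by linarith
  ultimately show "y < max 0 x powr p" using assms by (simp add: powr_powr)
qed

text \<open>The symmetry feeds the reflection argument, the density the moment of the
  endpoint.\<close>

lemma brownian_projection:
  fixes X :: "real \<Rightarrow> 'w \<Rightarrow> 'a::euclidean_space"
  assumes X: "standard_brownian_motion M X" and u: "u \<noteq> 0" and st: "0 \<le> s" "s < t"
  shows "distributed M lborel (\<lambda>\<omega>. X t \<omega> \<bullet> u - X s \<omega> \<bullet> u) (normal_density 0 (sqrt (t - s) * norm u))"
    and "distr M borel (\<lambda>\<omega>. - (X t \<omega> \<bullet> u - X s \<omega> \<bullet> u)) = distr M borel (\<lambda>\<omega>. X t \<omega> \<bullet> u - X s \<omega> \<bullet> u)"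
proof -
  interpret prob_space M using X by (simp add: standard_brownian_motion_def)
  have "distributed M lborel (\<lambda>\<omega>. X t \<omega> - X s \<omega>)
          (\<lambda>x. ennreal (\<Prod>b\<in>Basis. normal_density 0 (sqrt (t - s)) (x \<bullet> b)))"
    using X st unfolding standard_brownian_motion_def by blast
  from distributed_inner_normal[OF this _ u]
  show N: "distributed M lborel (\<lambda>\<omega>. X t \<omega> \<bullet> u - X s \<omega> \<bullet> u) (normal_density 0 (sqrt (t - s) * norm u))"
    using st by (simp add: inner_diff_left)
  have "distributed M lborel (\<lambda>\<omega>. 0 + (- 1) * (X t \<omega> \<bullet> u - X s \<omega> \<bullet> u))
      (normal_density (0 + (- 1) * 0) (\<bar>- 1\<bar> * (sqrt (t - s) * norm u)))"
    using st u by (intro normal_density_affine N) auto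
  then have "distributed M lborel (\<lambda>\<omega>. - (X t \<omega> \<bullet> u - X s \<omega> \<bullet> u)) (normal_density 0 (sqrt (t - s) * norm u))"
    by simp
  then have "distr M lborel (\<lambda>\<omega>. - (X t \<omega> \<bullet> u - X s \<omega> \<bullet> u)) = distr M lborel (\<lambda>\<omega>. X t \<omega> \<bullet> u - X s \<omega> \<bullet> u)"
    using N by (simp only: distributed_distr_eq_density)
  then show "distr M borel (\<lambda>\<omega>. - (X t \<omega> \<bullet> u - X s \<omega> \<bullet> u)) = distr M borel (\<lambda>\<omega>. X t \<omega> \<bullet> u - X s \<omega> \<bullet> u)"
    by (simp only: distr_cong[OF refl sets_lborel refl])
qed

text \<open>By reflection, the tail of the supremum is twice that of the truncated power of the
  endpoint at every nonnegative level; integrating tails turns this into twice a one-sided normal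
  moment with standard deviation \<open>norm u\<close>. The direction \<open>u = 0\<close>, whose
  projection has no density, is trivial.\<close>

lemma brownian_maximum_moment:
  fixes X :: "real \<Rightarrow> 'w \<Rightarrow> 'a::euclidean_space"
  assumes X: "standard_brownian_motion M X" and p: "1 \<le> p"
  shows "(\<integral>\<^sup>+\<omega>. (SUP q\<in>unit_dyadics. ennreal (max 0 (X q \<omega> \<bullet> u) powr p)) \<partial>M)
    = ennreal (norm u powr p * (2 powr (p / 2) / sqrt pi * Gamma ((p + 1) / 2)))"
proof (cases "u = 0")
  case True
  have "unit_dyadics \<noteq> {}" unfolding unit_dyadics_def by blast
  with True p show ?thesis by simp
next
  case False
  interpret prob_space M using X by (simp add: standard_brownian_motion_def)
  have Xm: "X t \<in> borel_measurable M" if "0 \<le> t" for t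
    using X that by (simp add: standard_brownian_motion_def)
  define B where "B t \<omega> = X t \<omega> \<bullet> u" for t \<omega>
  have Bm: "B t \<in> borel_measurable M" if "0 \<le> t" for t
    unfolding B_def using Xm[OF that] by measurable
  have [measurable]: "B 1 \<in> borel_measurable M" by (rule Bm) simp
  have indep: "indep_vars (\<lambda>_. borel) (\<lambda>i \<omega>. B (real (Suc i) / 2 ^ m) \<omega> - B (real i / 2 ^ m) \<omega>) {..<2 ^ m}" for m :: nat
  proof -
    have "indep_vars (\<lambda>_. borel) (\<lambda>i \<omega>. X (real (Suc i) / 2 ^ m) \<omega> - X (real i / 2 ^ m) \<omega>) {..<2 ^ m}"
    proof -
      have "\<forall>(n::nat) \<tau>. 0 \<le> \<tau> 0 \<and> (\<forall>i<n. \<tau> i < \<tau> (Suc i)) \<longrightarrow>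
        indep_vars (\<lambda>_. borel) (\<lambda>i \<omega>. X (\<tau> (Suc i)) \<omega> - X (\<tau> i) \<omega>) {..<n}"
        using X unfolding standard_brownian_motion_def by blast
      from this[rule_format, of "\<lambda>i. real i / 2 ^ m" "2 ^ m"] show ?thesis
        by (simp add: divide_strict_right_mono)
    qed
    then have "indep_vars (\<lambda>_. borel) (\<lambda>i \<omega>. (X (real (Suc i) / 2 ^ m) \<omega> - X (real i / 2 ^ m) \<omega>) \<bullet> u) {..<2 ^ m}"
      by (rule indep_vars_compose2[where Y = "\<lambda>_ x. x \<bullet> u"]) measurable
    then show ?thesis by (simp add: B_def inner_diff_left)
  qed
  have start: "AE \<omega> in M. B 0 \<omega> = 0"
    using X unfolding standard_brownian_motion_def B_def by auto
  have cont: "AE \<omega> in M. continuous_on {0..} (\<lambda>t. B t \<omega>)"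
  proof -
    have "AE \<omega> in M. continuous_on {0..} (\<lambda>t. X t \<omega>)"
      using X unfolding standard_brownian_motion_def by blast
    then show ?thesis unfolding B_def by eventually_elim (intro continuous_intros)
  qed
  have sym: "distr M borel (\<lambda>\<omega>. - (B t \<omega> - B s \<omega>)) = distr M borel (\<lambda>\<omega>. B t \<omega> - B s \<omega>)"
    if "0 \<le> s" "s < t" for s t
    unfolding B_def by (rule brownian_projection(2)[OF X False that])
  note reflection = reflection_principle[OF Bm indep sym start cont]
  define W where "W \<omega> = (SUP q\<in>unit_dyadics. ennreal (max 0 (B q \<omega>) powr p))" for \<omega>
  have Wm [measurable]: "W \<in> borel_measurable M"
    unfolding W_def
  proof (rule borel_measurable_SUP[OF countable_unit_dyadics])
    fix q assume "q \<in> unit_dyadics"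
    then have "B q \<in> borel_measurable M" using unit_dyadics_subset by (intro Bm) auto
    then show "(\<lambda>\<omega>. ennreal (max 0 (B q \<omega>) powr p)) \<in> borel_measurable M" by measurable
  qed
  define W1 where "W1 \<omega> = ennreal (max 0 (B 1 \<omega>) powr p)" for \<omega>
  have W1m [measurable]: "W1 \<in> borel_measurable M" unfolding W1_def by measurable
  have tail: "emeasure M {\<omega>\<in>space M. ennreal y < W \<omega>} = 2 * emeasure M {\<omega>\<in>space M. ennreal y < W1 \<omega>}"
    if y: "0 \<le> y" for y
  proof -
    have iff: "ennreal y < ennreal (max 0 x powr p) \<longleftrightarrow> y powr (1 / p) < x" for x
      using less_positive_part_powr_iff[OF y, of p x] p y by (simp add: ennreal_less_iff)
    have "{\<omega>\<in>space M. ennreal y < W \<omega>} = {\<omega>\<in>space M. \<exists>m. \<exists>k\<le>2 ^ m. y powr (1 / p) < B (real k / 2 ^ m) \<omega>}"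
      unfolding W_def less_SUP_iff iff unit_dyadics_def by auto
    moreover have "{\<omega>\<in>space M. ennreal y < W1 \<omega>} = {\<omega>\<in>space M. y powr (1 / p) < B 1 \<omega>}"
      unfolding W1_def iff ..
    ultimately show ?thesis
      using reflection[of "y powr (1 / p)"] by (simp add: emeasure_eq_measure ennreal_mult')
  qed
  have "(\<integral>\<^sup>+\<omega>. W \<omega> \<partial>M) = (\<integral>\<^sup>+y. indicator {0..} y * emeasure M {\<omega>\<in>space M. ennreal y < W \<omega>} \<partial>lborel)"
    by (rule nn_integral_layer_cake[OF Wm])
  also have "\<dots> = (\<integral>\<^sup>+y. 2 * (indicator {0..} y * emeasure M {\<omega>\<in>space M. ennreal y < W1 \<omega>}) \<partial>lborel)"
    by (intro nn_integral_cong) (auto simp: indicator_def tail)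
  also have "\<dots> = 2 * (\<integral>\<^sup>+y. indicator {0..} y * emeasure M {\<omega>\<in>space M. ennreal y < W1 \<omega>} \<partial>lborel)"
    by (rule nn_integral_cmult) measurable
  also have "(\<integral>\<^sup>+y. indicator {0..} y * emeasure M {\<omega>\<in>space M. ennreal y < W1 \<omega>} \<partial>lborel) = (\<integral>\<^sup>+\<omega>. W1 \<omega> \<partial>M)"
    by (rule nn_integral_layer_cake[OF W1m, symmetric])
  \<comment> \<open>\<open>standard_brownian_motion\<close> prescribes laws of increments, so the
    endpoint is replaced by the increment from time 0, to which it is almost surely equal.\<close>
  also have "\<dots> = (\<integral>\<^sup>+\<omega>. ennreal (max 0 (B 1 \<omega> - B 0 \<omega>) powr p) \<partial>M)"
    unfolding W1_def using start by (intro nn_integral_cong_AE) auto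
  also have "\<dots> = (\<integral>\<^sup>+x. ennreal (normal_density 0 (norm u) x) * ennreal (max 0 x powr p) \<partial>lborel)"
  proof (rule distributed_nn_integral[symmetric])
    show "distributed M lborel (\<lambda>\<omega>. B 1 \<omega> - B 0 \<omega>) (normal_density 0 (norm u))"
      using brownian_projection(1)[OF X False, of 0 1] by (simp add: B_def)
  qed measurable
  also have "\<dots> = ennreal (norm u powr p * 2 powr (p / 2) / (2 * sqrt pi) * Gamma ((p + 1) / 2))"
    using False p by (intro normal_positive_part_moment) auto
  also have "2 * \<dots> = ennreal (2 * (norm u powr p * 2 powr (p / 2) / (2 * sqrt pi) * Gamma ((p + 1) / 2)))"
    by (subst ennreal_mult'[of 2]) simp_all
  also have "2 * (norm u powr p * 2 powr (p / 2) / (2 * sqrt pi) * Gamma ((p + 1) / 2))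
    = norm u powr p * (2 powr (p / 2) / sqrt pi * Gamma ((p + 1) / 2))"
    by simp
  finally show ?thesis by (simp add: W_def B_def)
qed

text \<open>The two preimages differ by a subset of a null set, which the completion measures. The
  application is to the mixed volume of the hull, about which nothing is known on exceptional
  paths.\<close>

lemma borel_measurable_completion_cong_AE:
  fixes f :: "'a \<Rightarrow> real"
  assumes f: "f \<in> borel_measurable M" and ae: "AE x in M. f x = h x"
  shows "h \<in> borel_measurable (completion M)"
proof (rule measurableI)
  fix A :: "real set" assume A: "A \<in> sets borel"
  show "h -` A \<inter> space (completion M) \<in> sets (completion M)"
  proof (rule completion.in_sets_AE)
    show "f -` A \<inter> space M \<in> sets (completion M)"
      using measurable_sets[OF f A] by (rule sets_completionI_sets)
    show "AE x in completion M. x \<in> f -` A \<inter> space M \<longleftrightarrow> x \<in> h -` A \<inter> space (completion M)"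
      using AE_completion[OF ae] by eventually_elim auto
  qed auto
qed simp

theorem theorem4p2:
  fixes L :: "'a::euclidean_space set"
    and M :: "'w measure"
    and X :: "real \<Rightarrow> 'w \<Rightarrow> 'a"
    and p :: real
  assumes "convex_body L" and "0 \<in> interior L"
    and "standard_brownian_motion M X"
    and "1 \<le> p"
  shows "integrable (completion M) (\<lambda>\<omega>. Lp_mixed_volume p L (path_hull X \<omega>)) \<and>
    (\<integral>\<omega>. Lp_mixed_volume p L (path_hull X \<omega>) \<partial>completion M) =
      2 powr (p / 2) / sqrt pi * Gamma ((p + 1) / 2) * Lp_mixed_volume p L (cball 0 1)"
proof -
  interpret pointed_body L using assms by unfold_locales
  note X = assms(3) and p = assms(4)
  interpret prob_space M using X by (simp add: standard_brownian_motion_def)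
  interpret pair_sigma_finite lborel M ..
  define C where "C = 2 powr (p / 2) / sqrt pi * Gamma ((p + 1) / 2)"
  have C0: "0 \<le> C" using p by (auto simp: C_def intro!: mult_nonneg_nonneg less_imp_le[OF Gamma_real_pos])
  have [measurable]: "g \<in> borel_measurable borel" by (rule borel_measurable_wgauge) auto
  have g0: "0 \<le> g x" for x by (rule wgauge_nonneg) auto
  define \<phi> where "\<phi> x = exp (- g x) * g x / (real DIM('a) * fact DIM('a))" for x
  have [measurable]: "\<phi> \<in> borel_measurable borel" unfolding \<phi>_def by measurable
  have \<phi>0: "0 \<le> \<phi> x" for x using g0[of x] by (simp add: \<phi>_def)
  \<comment> \<open>Stated with nonnegative integrals, so that Tonelli applies before integrability
    over the paths is known.\<close>
  have V: "ennreal (Lp_mixed_volume p L K) = (\<integral>\<^sup>+x. ennreal (\<phi> x) * ennreal (support_function K (normal x) powr p) \<partial>lborel)"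
    "0 \<le> Lp_mixed_volume p L K"
    if K: "convex_body K" "0 \<in> K" for K
  proof -
    note int = Lp_mixed_volume_eq[OF K p]
    have int': "integrable lborel (\<lambda>x. \<phi> x * support_function K (normal x) powr p)"
      using integrable_divide_zero[OF int(1), of "real DIM('a) * fact DIM('a)"] by (simp add: \<phi>_def)
    have eq: "Lp_mixed_volume p L K = (\<integral>x. \<phi> x * support_function K (normal x) powr p \<partial>lborel)"
      unfolding int(2) by (simp add: \<phi>_def)
    show "0 \<le> Lp_mixed_volume p L K"
      unfolding eq using \<phi>0 by (intro Bochner_Integration.integral_nonneg) auto
    show "ennreal (Lp_mixed_volume p L K) = (\<integral>\<^sup>+x. ennreal (\<phi> x) * ennreal (support_function K (normal x) powr p) \<partial>lborel)"
      unfolding eq using \<phi>0 by (subst nn_integral_eq_integral[OF int', symmetric]) (auto simp: ennreal_mult')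
  qed
  have cball: "convex_body (cball (0::'a) 1)" "0 \<in> cball (0::'a) 1" by (auto simp: convex_body_def)
  have h_cball: "support_function (cball 0 1) u = norm u" for u :: 'a
  proof (cases "u = 0")
    case True
    then show ?thesis by (intro support_function_eqI[where x = 0]) auto
  next
    case False
    show ?thesis
    proof (rule support_function_eqI[where x = "(1 / norm u) *\<^sub>R u"])
      show "x \<bullet> u \<le> norm u" if "x \<in> cball 0 1" for x
        using norm_cauchy_schwarz[of x u] mult_right_mono[of "norm x" 1 "norm u"] that by simp
    qed (use False in \<open>auto simp: dot_square_norm power2_eq_square\<close>)
  qed
  define V' where "V' \<omega> = Lp_mixed_volume p L (path_hull X \<omega>)" for \<omega>
  \<comment> \<open>A version of the mixed volume in which a dyadic supremum replaces the support
    function of the hull. The integrand is jointly measurable in point and path, which makes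
    \<open>U\<close> measurable on \<open>M\<close> itself.\<close>
  define U where "U \<omega> = (\<integral>\<^sup>+x. ennreal (\<phi> x) * (SUP q\<in>unit_dyadics. ennreal (max 0 (X q \<omega> \<bullet> normal x) powr p)) \<partial>lborel)" for \<omega>
  have meas: "(\<lambda>(x, \<omega>). ennreal (\<phi> x) * (SUP q\<in>unit_dyadics. ennreal (max 0 (X q \<omega> \<bullet> normal x) powr p)))
      \<in> borel_measurable (lborel \<Otimes>\<^sub>M M)"
  proof -
    have "(\<lambda>z. SUP q\<in>unit_dyadics. ennreal (max 0 (X q (snd z) \<bullet> normal (fst z)) powr p)) \<in> borel_measurable (lborel \<Otimes>\<^sub>M M)"
    proof (rule borel_measurable_SUP[OF countable_unit_dyadics])
      fix q assume "q \<in> unit_dyadics"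
      then have [measurable]: "X q \<in> borel_measurable M"
        using X unit_dyadics_subset by (auto simp: standard_brownian_motion_def)
      show "(\<lambda>z. ennreal (max 0 (X q (snd z) \<bullet> normal (fst z)) powr p)) \<in> borel_measurable (lborel \<Otimes>\<^sub>M M)"
        by measurable
    qed
    then show ?thesis unfolding case_prod_beta by measurable
  qed
  have Um: "U \<in> borel_measurable M"
    unfolding U_def using measurable_pair_swap[OF meas]
    by (intro lborel.borel_measurable_nn_integral) (simp add: case_prod_beta)
  have AE_U: "AE \<omega> in M. ennreal (V' \<omega>) = U \<omega> \<and> 0 \<le> V' \<omega>"
  proof -
    have "AE \<omega> in M. X 0 \<omega> = 0" "AE \<omega> in M. continuous_on {0..} (\<lambda>t. X t \<omega>)"
      using X unfolding standard_brownian_motion_def by blast+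
    then show ?thesis
    proof eventually_elim
      case (elim \<omega>)
      then have c: "continuous_on {0..1} (\<lambda>t. X t \<omega>)" by (auto intro: continuous_on_subset)
      note K = path_hull_convex_body(1,2)[of X \<omega>, OF c elim(1)]
      show ?case
        unfolding V'_def U_def using V[OF K] p
        by (simp add: support_function_path_hull_powr[of X \<omega>, OF c elim(1)])
    qed
  qed
  have V'm: "V' \<in> borel_measurable (completion M)"
  proof (rule borel_measurable_completion_cong_AE)
    show "(\<lambda>\<omega>. enn2real (U \<omega>)) \<in> borel_measurable M" using Um by measurable
    show "AE \<omega> in M. enn2real (U \<omega>) = V' \<omega>"
      using AE_U by eventually_elim (metis enn2real_ennreal)
  qed
  have "(\<integral>\<^sup>+\<omega>. ennreal (V' \<omega>) \<partial>completion M) = (\<integral>\<^sup>+\<omega>. U \<omega> \<partial>M)"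
    unfolding nn_integral_completion using AE_U by (intro nn_integral_cong_AE) auto
  also have "\<dots> = (\<integral>\<^sup>+x. (\<integral>\<^sup>+\<omega>. ennreal (\<phi> x) * (SUP q\<in>unit_dyadics. ennreal (max 0 (X q \<omega> \<bullet> normal x) powr p)) \<partial>M) \<partial>lborel)"
    unfolding U_def by (rule Fubini'[OF meas])
  \<comment> \<open>For fixed \<open>x\<close> the vector \<open>normal x\<close> is deterministic,
    so the moment of the projected maximum applies. It gives \<open>C\<close> times the p-th power
    of the norm of \<open>normal x\<close>, and the norm is the support function of the unit
    ball.\<close>
  also have "\<dots> = (\<integral>\<^sup>+x. ennreal C * (ennreal (\<phi> x) * ennreal (support_function (cball 0 1) (normal x) powr p)) \<partial>lborel)"
  proof (intro nn_integral_cong)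
    fix x :: 'a
    have "(\<lambda>\<omega>. SUP q\<in>unit_dyadics. ennreal (max 0 (X q \<omega> \<bullet> normal x) powr p)) \<in> borel_measurable M"
    proof (rule borel_measurable_SUP[OF countable_unit_dyadics])
      fix q assume "q \<in> unit_dyadics"
      then have [measurable]: "X q \<in> borel_measurable M"
        using X unit_dyadics_subset by (auto simp: standard_brownian_motion_def)
      show "(\<lambda>\<omega>. ennreal (max 0 (X q \<omega> \<bullet> normal x) powr p)) \<in> borel_measurable M" by measurable
    qed
    then have "(\<integral>\<^sup>+\<omega>. ennreal (\<phi> x) * (SUP q\<in>unit_dyadics. ennreal (max 0 (X q \<omega> \<bullet> normal x) powr p)) \<partial>M)
      = ennreal (\<phi> x) * ennreal (norm (normal x) powr p * C)"
      by (simp add: nn_integral_cmult brownian_maximum_moment[OF X p] C_def)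
    also have "\<dots> = ennreal C * (ennreal (\<phi> x) * ennreal (support_function (cball 0 1) (normal x) powr p))"
      using C0 by (simp add: h_cball ennreal_mult' ac_simps)
    finally show "(\<integral>\<^sup>+\<omega>. ennreal (\<phi> x) * (SUP q\<in>unit_dyadics. ennreal (max 0 (X q \<omega> \<bullet> normal x) powr p)) \<partial>M)
      = ennreal C * (ennreal (\<phi> x) * ennreal (support_function (cball 0 1) (normal x) powr p))" .
  qed
  also have "\<dots> = ennreal C * (\<integral>\<^sup>+x. ennreal (\<phi> x) * ennreal (support_function (cball 0 1) (normal x) powr p) \<partial>lborel)"
    by (rule nn_integral_cmult) (simp add: h_cball)
  also have "\<dots> = ennreal (C * Lp_mixed_volume p L (cball 0 1))"
    using C0 by (simp add: V(1)[OF cball, symmetric] ennreal_mult')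
  finally have total: "(\<integral>\<^sup>+\<omega>. ennreal (V' \<omega>) \<partial>completion M) = ennreal (C * Lp_mixed_volume p L (cball 0 1))" .
  have nonneg: "AE \<omega> in completion M. 0 \<le> V' \<omega>"
    using AE_completion[OF AE_U] by eventually_elim simp
  \<comment> \<open>The total is a finite real number, so integrability comes out of the computation
    itself.\<close>
  have "integrable (completion M) V'"
    by (rule integrableI_nn_integral_finite[OF V'm nonneg total])
  moreover have "(\<integral>\<omega>. V' \<omega> \<partial>completion M) = C * Lp_mixed_volume p L (cball 0 1)"
    unfolding integral_eq_nn_integral[OF V'm nonneg] total using C0 V(2)[OF cball] by simp
  ultimately show ?thesis by (simp add: V'_def[abs_def] C_def)
qed

end
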